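(* Let $(M,g)$ be a Riemannian manifold of dimension $n$. Then $(\widetilde{TM},h_{\tilde J},\tilde Q)$ is an almost para-Hermitian manifold; that is, $\tilde Q^2=I$ and $h_{\tilde J}(\tilde QX,\tilde QY)=-h_{\tilde J}(X,Y)$ for all vector fields $X,Y$ on $\widetilde{TM}$.
   Context: Let $(x^i)$ be local coordinates on $M$, $(x^i,y^i)$ the induced coordinates on $TM$, $\widetilde{TM}=TM\setminus\{0\}$ the tangent bundle minus its zero section, $g_{ij}$ the components of $g$, $\Gamma_{ij}{}^k$ the Christoffel symbols of its Levi-Civita connection; the summation convention is used. Put $\|y\|=\sqrt{g_{ij}(x)y^iy^j}$. Define the local frame $X_i=\frac{\partial}{\partial x^i}-y^a\Gamma_{ai}{}^m\frac{\partial}{\partial y^m}$, $X_{\bar i}=\frac{\partial}{\partial y^i}$ of $T\widetilde{TM}$, with dual coframe $dx^i$, $\delta y^i=dy^i+y^a\Gamma_{aj}{}^i dx^j$. $h_{\tilde J}$ is the pseudo-Riemannian metric $h_{\tilde J}=-2g_{ij}dx^idx^j+\frac{2g_{ij}}{\|y\|^2}\delta y^i\delta y^j$, i.e. $h_{\tilde J}(X_i,X_j)=-2g_{ij}$, $h_{\tilde J}(X_i,X_{\bar j})=0$, $h_{\tilde J}(X_{\bar i},X_{\bar j})=\frac{2}{\|y\|^2}g_{ij}$. $\tilde Q$ is the $(1,1)$ tensor field on $\widetilde{TM}$ given by $\tilde Q(X_i)=\|y\|X_{\bar i}$, $\tilde Q(X_{\bar i})=\frac1{\|y\|}X_i$.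 *)

theory Defs
  imports "HOL-Analysis.Analysis"
begin

section \<open>Smooth maps between Euclidean spaces\<close>

text \<open>Only used for open \<open>S\<close>.\<close>

primrec Ck_on :: "nat \<Rightarrow> ('a::euclidean_space \<Rightarrow> 'b::real_normed_vector) \<Rightarrow> 'a set \<Rightarrow> bool" where
  "Ck_on 0 f S \<longleftrightarrow> continuous_on S f"
| "Ck_on (Suc k) f S \<longleftrightarrow>
     (\<forall>x\<in>S. f differentiable (at x)) \<and> (\<forall>v. Ck_on k (\<lambda>x. frechet_derivative f (at x) v) S)"

definition smooth_on :: "('a::euclidean_space \<Rightarrow> 'b::real_normed_vector) \<Rightarrow> 'a set \<Rightarrow> bool" where
  "smooth_on f S \<longleftrightarrow> (\<forall>k. Ck_on k f S)"


section \<open>Smooth manifolds\<close>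

text \<open>A chart is a pair of a domain and a coordinate map, which is irrelevant off the domain.
  The topology of a manifold is the one determined by its atlas. The atlas need not be maximal;
  a maximal one is a special case.\<close>

type_synonym ('p, 'e) chart = "'p set \<times> ('p \<Rightarrow> 'e)"

abbreviation chart_dom :: "('p, 'e) chart \<Rightarrow> 'p set" where
  "chart_dom \<equiv> fst"

abbreviation chart_map :: "('p, 'e) chart \<Rightarrow> 'p \<Rightarrow> 'e" where
  "chart_map \<equiv> snd"

definition chart_inv :: "('p, 'e) chart \<Rightarrow> 'e \<Rightarrow> 'p" where
  "chart_inv c = inv_into (chart_dom c) (chart_map c)"

definition transition :: "('p, 'e) chart \<Rightarrow> ('p, 'e) chart \<Rightarrow> 'e \<Rightarrow> 'e" where
  "transition c d = chart_map d \<circ> chart_inv c"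

definition smooth_atlas :: "'p set \<Rightarrow> ('p, 'e::euclidean_space) chart set \<Rightarrow> bool" where
  "smooth_atlas M A \<longleftrightarrow>
     M = (\<Union>c\<in>A. chart_dom c) \<and>
     (\<forall>c\<in>A. inj_on (chart_map c) (chart_dom c)) \<and>
     (\<forall>c\<in>A. \<forall>d\<in>A. open (chart_map c ` (chart_dom c \<inter> chart_dom d)) \<and>
        smooth_on (transition c d) (chart_map c ` (chart_dom c \<inter> chart_dom d)))"

definition atlas_topology :: "'p set \<Rightarrow> ('p, 'e::euclidean_space) chart set \<Rightarrow> 'p topology" where
  "atlas_topology M A =
     topology (\<lambda>W. W \<subseteq> M \<and> (\<forall>c\<in>A. open (chart_map c ` (W \<inter> chart_dom c))))"

lemma openin_atlas_topology:
  assumes "smooth_atlas M A"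
  shows "openin (atlas_topology M A) W \<longleftrightarrow>
    W \<subseteq> M \<and> (\<forall>c\<in>A. open (chart_map c ` (W \<inter> chart_dom c)))"
proof -
  have inj: "inj_on (chart_map c) (chart_dom c)" if "c \<in> A" for c
    using assms that by (auto simp: smooth_atlas_def)
  have "istopology (\<lambda>W. W \<subseteq> M \<and> (\<forall>c\<in>A. open (chart_map c ` (W \<inter> chart_dom c))))"
    unfolding istopology_def
  proof (intro conjI allI impI ballI)
    fix S T c assume S: "S \<subseteq> M \<and> (\<forall>c\<in>A. open (chart_map c ` (S \<inter> chart_dom c)))"
      and T: "T \<subseteq> M \<and> (\<forall>c\<in>A. open (chart_map c ` (T \<inter> chart_dom c)))" and c: "c \<in> A"
    have "chart_map c ` (S \<inter> T \<inter> chart_dom c) =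
          chart_map c ` (S \<inter> chart_dom c) \<inter> chart_map c ` (T \<inter> chart_dom c)"
      using inj[OF c] by (auto simp: inj_on_def)
    then show "open (chart_map c ` (S \<inter> T \<inter> chart_dom c))"
      using S T c by auto
  next
    fix \<K> c
    assume K: "\<forall>K\<in>\<K>. K \<subseteq> M \<and> (\<forall>c\<in>A. open (chart_map c ` (K \<inter> chart_dom c)))" and c: "c \<in> A"
    have "chart_map c ` (\<Union>\<K> \<inter> chart_dom c) = (\<Union>K\<in>\<K>. chart_map c ` (K \<inter> chart_dom c))"
      by auto
    then show "open (chart_map c ` (\<Union>\<K> \<inter> chart_dom c))"
      using K c by auto
  qed auto
  then show ?thesis
    by (simp add: atlas_topology_def topology_inverse')
qed

definition second_countable_space :: "'a topology \<Rightarrow> bool" where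
  "second_countable_space X \<longleftrightarrow>
     (\<exists>\<B>. countable \<B> \<and> (\<forall>V\<in>\<B>. openin X V) \<and>
        (\<forall>U x. openin X U \<and> x \<in> U \<longrightarrow> (\<exists>V\<in>\<B>. x \<in> V \<and> V \<subseteq> U)))"

definition smooth_manifold :: "'p set \<Rightarrow> ('p, 'e::euclidean_space) chart set \<Rightarrow> bool" where
  "smooth_manifold M A \<longleftrightarrow> smooth_atlas M A \<and>
     Hausdorff_space (atlas_topology M A) \<and> second_countable_space (atlas_topology M A)"


section \<open>Tangent vectors and tensor fields\<close>

text \<open>A tangent vector at \<open>p\<close> assigns to each chart around \<open>p\<close> its component vector in that chart,
  the components in two charts being related by the Jacobian of the transition map. Away from
  the charts around \<open>p\<close> the value is normalised to \<open>0\<close>, so that vectors are equal iff their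
  components are. The vector space operations are pointwise.\<close>

type_synonym ('p, 'e) tvec = "('p, 'e) chart \<Rightarrow> 'e"

definition tangent_space ::
    "('p, 'e::euclidean_space) chart set \<Rightarrow> 'p \<Rightarrow> ('p, 'e) tvec set" where
  "tangent_space A p = {v.
     (\<forall>c\<in>A. \<forall>d\<in>A. p \<in> chart_dom c \<and> p \<in> chart_dom d \<longrightarrow>
        v d = frechet_derivative (transition c d) (at (chart_map c p)) (v c)) \<and>
     (\<forall>c. \<not> (c \<in> A \<and> p \<in> chart_dom c) \<longrightarrow> v c = 0)}"

text \<open>The tangent vector at \<open>p\<close> with components \<open>e\<close> in the chart \<open>c\<close>; for a basis vector \<open>e\<close> this
  is the coordinate vector \<open>\<partial>\<^sub>e\<close> of \<open>c\<close> at \<open>p\<close>.\<close>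

definition coord_vec ::
    "('p, 'e::euclidean_space) chart set \<Rightarrow> ('p, 'e) chart \<Rightarrow> 'p \<Rightarrow> 'e \<Rightarrow> ('p, 'e) tvec" where
  "coord_vec A c p e = (\<lambda>d.
     if d \<in> A \<and> p \<in> chart_dom d
     then frechet_derivative (transition c d) (at (chart_map c p)) e else 0)"

definition vector_field ::
    "'p set \<Rightarrow> ('p, 'e::euclidean_space) chart set \<Rightarrow> ('p \<Rightarrow> ('p, 'e) tvec) \<Rightarrow> bool" where
  "vector_field M A X \<longleftrightarrow>
     (\<forall>p\<in>M. X p \<in> tangent_space A p) \<and>
     (\<forall>c\<in>A. smooth_on (\<lambda>x. X (chart_inv c x) c) (chart_map c ` chart_dom c))"

definition tensor_02 ::
    "'p set \<Rightarrow> ('p, 'e::euclidean_space) chart set \<Rightarrow>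
     ('p \<Rightarrow> ('p, 'e) tvec \<Rightarrow> ('p, 'e) tvec \<Rightarrow> real) \<Rightarrow> bool" where
  "tensor_02 M A h \<longleftrightarrow>
     (\<forall>p\<in>M. \<forall>u\<in>tangent_space A p. \<forall>v\<in>tangent_space A p. \<forall>w\<in>tangent_space A p. \<forall>a b.
        h p (\<lambda>c. a *\<^sub>R u c + b *\<^sub>R v c) w = a * h p u w + b * h p v w \<and>
        h p w (\<lambda>c. a *\<^sub>R u c + b *\<^sub>R v c) = a * h p w u + b * h p w v) \<and>
     (\<forall>c\<in>A. \<forall>e\<in>Basis. \<forall>f\<in>Basis.
        smooth_on (\<lambda>x. h (chart_inv c x) (coord_vec A c (chart_inv c x) e)
                                         (coord_vec A c (chart_inv c x) f))
          (chart_map c ` chart_dom c))"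

definition tensor_11 ::
    "'p set \<Rightarrow> ('p, 'e::euclidean_space) chart set \<Rightarrow>
     ('p \<Rightarrow> ('p, 'e) tvec \<Rightarrow> ('p, 'e) tvec) \<Rightarrow> bool" where
  "tensor_11 M A Q \<longleftrightarrow>
     (\<forall>p\<in>M. \<forall>u\<in>tangent_space A p. Q p u \<in> tangent_space A p) \<and>
     (\<forall>p\<in>M. \<forall>u\<in>tangent_space A p. \<forall>v\<in>tangent_space A p. \<forall>a b.
        Q p (\<lambda>c. a *\<^sub>R u c + b *\<^sub>R v c) = (\<lambda>c. a *\<^sub>R Q p u c + b *\<^sub>R Q p v c)) \<and>
     (\<forall>c\<in>A. \<forall>e\<in>Basis.
        smooth_on (\<lambda>x. Q (chart_inv c x) (coord_vec A c (chart_inv c x) e) c)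
          (chart_map c ` chart_dom c))"

definition pseudo_riemannian_metric ::
    "'p set \<Rightarrow> ('p, 'e::euclidean_space) chart set \<Rightarrow>
     ('p \<Rightarrow> ('p, 'e) tvec \<Rightarrow> ('p, 'e) tvec \<Rightarrow> real) \<Rightarrow> bool" where
  "pseudo_riemannian_metric M A h \<longleftrightarrow> tensor_02 M A h \<and>
     (\<forall>p\<in>M. \<forall>u\<in>tangent_space A p. \<forall>v\<in>tangent_space A p. h p u v = h p v u) \<and>
     (\<forall>p\<in>M. \<forall>u\<in>tangent_space A p.
        (\<forall>v\<in>tangent_space A p. h p u v = 0) \<longrightarrow> u = (\<lambda>_. 0))"

definition riemannian_manifold ::
    "'p set \<Rightarrow> ('p, 'e::euclidean_space) chart set \<Rightarrow>
     ('p \<Rightarrow> ('p, 'e) tvec \<Rightarrow> ('p, 'e) tvec \<Rightarrow> real) \<Rightarrow> bool" where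
  "riemannian_manifold M A g \<longleftrightarrow> smooth_manifold M A \<and> tensor_02 M A g \<and>
     (\<forall>p\<in>M. \<forall>u\<in>tangent_space A p. \<forall>v\<in>tangent_space A p. g p u v = g p v u) \<and>
     (\<forall>p\<in>M. \<forall>u\<in>tangent_space A p. u \<noteq> (\<lambda>_. 0) \<longrightarrow> g p u u > 0)"

definition almost_para_hermitian_manifold ::
    "'p set \<Rightarrow> ('p, 'e::euclidean_space) chart set \<Rightarrow>
     ('p \<Rightarrow> ('p, 'e) tvec \<Rightarrow> ('p, 'e) tvec \<Rightarrow> real) \<Rightarrow>
     ('p \<Rightarrow> ('p, 'e) tvec \<Rightarrow> ('p, 'e) tvec) \<Rightarrow> bool" where
  "almost_para_hermitian_manifold M A h Q \<longleftrightarrow>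
     smooth_manifold M A \<and> pseudo_riemannian_metric M A h \<and> tensor_11 M A Q \<and>
     (\<forall>p\<in>M. \<forall>u\<in>tangent_space A p. Q p (Q p u) = u) \<and>
     (\<forall>X Y. vector_field M A X \<and> vector_field M A Y \<longrightarrow>
        (\<forall>p\<in>M. h p (Q p (X p)) (Q p (Y p)) = - h p (X p) (Y p)))"


section \<open>Local expressions of a metric\<close>

definition metric_comp ::
    "('p, real^'n) chart set \<Rightarrow> ('p \<Rightarrow> ('p, real^'n) tvec \<Rightarrow> ('p, real^'n) tvec \<Rightarrow> real) \<Rightarrow>
     ('p, real^'n) chart \<Rightarrow> 'n \<Rightarrow> 'n \<Rightarrow> 'p \<Rightarrow> real" where
  "metric_comp A g c i j p = g p (coord_vec A c p (axis i 1)) (coord_vec A c p (axis j 1))"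

definition metric_inv_comp ::
    "('p, real^'n) chart set \<Rightarrow> ('p \<Rightarrow> ('p, real^'n) tvec \<Rightarrow> ('p, real^'n) tvec \<Rightarrow> real) \<Rightarrow>
     ('p, real^'n) chart \<Rightarrow> 'n \<Rightarrow> 'n \<Rightarrow> 'p \<Rightarrow> real" where
  "metric_inv_comp A g c k l p = matrix_inv (\<chi> i j. metric_comp A g c i j p) $ k $ l"

definition coord_deriv ::
    "('p, real^'n) chart \<Rightarrow> 'n \<Rightarrow> ('p \<Rightarrow> real) \<Rightarrow> 'p \<Rightarrow> real" where
  "coord_deriv c i f p = frechet_derivative (f \<circ> chart_inv c) (at (chart_map c p)) (axis i 1)"

text \<open>\<open>christoffel A g c i j k\<close> is \<open>\<Gamma>\<^sub>i\<^sub>j\<^sup>k\<close>, the Levi-Civita coefficients in the chart \<open>c\<close>.\<close>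

definition christoffel ::
    "('p, real^'n) chart set \<Rightarrow> ('p \<Rightarrow> ('p, real^'n) tvec \<Rightarrow> ('p, real^'n) tvec \<Rightarrow> real) \<Rightarrow>
     ('p, real^'n) chart \<Rightarrow> 'n \<Rightarrow> 'n \<Rightarrow> 'n \<Rightarrow> 'p \<Rightarrow> real" where
  "christoffel A g c i j k p = 1/2 * (\<Sum>l\<in>UNIV. metric_inv_comp A g c k l p *
     (coord_deriv c i (metric_comp A g c j l) p + coord_deriv c j (metric_comp A g c i l) p
      - coord_deriv c l (metric_comp A g c i j) p))"


section \<open>The slit tangent bundle\<close>

type_synonym ('p, 'e) tpoint = "'p \<times> ('p, 'e) tvec"

definition slit_tangent_bundle ::
    "'p set \<Rightarrow> ('p, 'e::euclidean_space) chart set \<Rightarrow> ('p, 'e) tpoint set" where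
  "slit_tangent_bundle M A = {(p, v). p \<in> M \<and> v \<in> tangent_space A p \<and> v \<noteq> (\<lambda>_. 0)}"

definition induced_chart ::
    "'p set \<Rightarrow> ('p, 'e::euclidean_space) chart set \<Rightarrow> ('p, 'e) chart \<Rightarrow>
     (('p, 'e) tpoint, 'e \<times> 'e) chart" where
  "induced_chart M A c =
     ({q \<in> slit_tangent_bundle M A. fst q \<in> chart_dom c}, \<lambda>(p, v). (chart_map c p, v c))"

definition slit_atlas ::
    "'p set \<Rightarrow> ('p, 'e::euclidean_space) chart set \<Rightarrow> (('p, 'e) tpoint, 'e \<times> 'e) chart set" where
  "slit_atlas M A = induced_chart M A ` A"

type_synonym ('p, 'e) ttvec = "(('p, 'e) tpoint, 'e \<times> 'e) tvec"

text \<open>In the following, \<open>q = (p, v)\<close> is a point of the slit tangent bundle with \<open>p\<close> in the domain of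
  the chart \<open>c\<close>; its fibre coordinates are \<open>y\<^sup>i = v c $ i\<close>.\<close>

definition fibre_norm ::
    "('p, real^'n) chart set \<Rightarrow> ('p \<Rightarrow> ('p, real^'n) tvec \<Rightarrow> ('p, real^'n) tvec \<Rightarrow> real) \<Rightarrow>
     ('p, real^'n) chart \<Rightarrow> ('p, real^'n) tpoint \<Rightarrow> real" where
  "fibre_norm A g c q = sqrt (\<Sum>i\<in>UNIV. \<Sum>j\<in>UNIV.
     metric_comp A g c i j (fst q) * snd q c $ i * snd q c $ j)"

definition vert_frame ::
    "'p set \<Rightarrow> ('p, real^'n) chart set \<Rightarrow> ('p, real^'n) chart \<Rightarrow> 'n \<Rightarrow>
     ('p, real^'n) tpoint \<Rightarrow> ('p, real^'n) ttvec" where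
  "vert_frame M A c i q = coord_vec (slit_atlas M A) (induced_chart M A c) q (0, axis i 1)"

definition hor_frame ::
    "'p set \<Rightarrow> ('p, real^'n) chart set \<Rightarrow>
     ('p \<Rightarrow> ('p, real^'n) tvec \<Rightarrow> ('p, real^'n) tvec \<Rightarrow> real) \<Rightarrow>
     ('p, real^'n) chart \<Rightarrow> 'n \<Rightarrow> ('p, real^'n) tpoint \<Rightarrow> ('p, real^'n) ttvec" where
  "hor_frame M A g c i q = (\<lambda>C.
     coord_vec (slit_atlas M A) (induced_chart M A c) q (axis i 1, 0) C
     - (\<Sum>m\<in>UNIV. (\<Sum>a\<in>UNIV. snd q c $ a * christoffel A g c a i m (fst q)) *\<^sub>R
          vert_frame M A c m q C))"

definition dx ::
    "'p set \<Rightarrow> ('p, real^'n) chart set \<Rightarrow> ('p, real^'n) chart \<Rightarrow> 'n \<Rightarrow>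
     ('p, real^'n) ttvec \<Rightarrow> real" where
  "dx M A c i \<xi> = fst (\<xi> (induced_chart M A c)) $ i"

definition delta_y ::
    "'p set \<Rightarrow> ('p, real^'n) chart set \<Rightarrow>
     ('p \<Rightarrow> ('p, real^'n) tvec \<Rightarrow> ('p, real^'n) tvec \<Rightarrow> real) \<Rightarrow>
     ('p, real^'n) chart \<Rightarrow> 'n \<Rightarrow> ('p, real^'n) tpoint \<Rightarrow> ('p, real^'n) ttvec \<Rightarrow> real" where
  "delta_y M A g c i q \<xi> = snd (\<xi> (induced_chart M A c)) $ i +
     (\<Sum>a\<in>UNIV. \<Sum>j\<in>UNIV. snd q c $ a * christoffel A g c a j i (fst q) * dx M A c j \<xi>)"


section \<open>The metric and the almost product structure on the slit tangent bundle\<close>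

text \<open>Both tensors are given by an expression in an arbitrary chart \<open>c\<close> of the base; the global
  objects are the values common to all charts around the base point.\<close>

definition h_J_local ::
    "'p set \<Rightarrow> ('p, real^'n) chart set \<Rightarrow>
     ('p \<Rightarrow> ('p, real^'n) tvec \<Rightarrow> ('p, real^'n) tvec \<Rightarrow> real) \<Rightarrow> ('p, real^'n) chart \<Rightarrow>
     ('p, real^'n) tpoint \<Rightarrow> ('p, real^'n) ttvec \<Rightarrow> ('p, real^'n) ttvec \<Rightarrow> real" where
  "h_J_local M A g c q \<xi> \<eta> =
     (\<Sum>i\<in>UNIV. \<Sum>j\<in>UNIV. - 2 * metric_comp A g c i j (fst q) * dx M A c i \<xi> * dx M A c j \<eta>) +
     (\<Sum>i\<in>UNIV. \<Sum>j\<in>UNIV. 2 * metric_comp A g c i j (fst q) / (fibre_norm A g c q)\<^sup>2 *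
        delta_y M A g c i q \<xi> * delta_y M A g c j q \<eta>)"

definition h_J ::
    "'p set \<Rightarrow> ('p, real^'n) chart set \<Rightarrow>
     ('p \<Rightarrow> ('p, real^'n) tvec \<Rightarrow> ('p, real^'n) tvec \<Rightarrow> real) \<Rightarrow>
     ('p, real^'n) tpoint \<Rightarrow> ('p, real^'n) ttvec \<Rightarrow> ('p, real^'n) ttvec \<Rightarrow> real" where
  "h_J M A g q \<xi> \<eta> =
     (THE r. \<forall>c\<in>A. fst q \<in> chart_dom c \<longrightarrow> r = h_J_local M A g c q \<xi> \<eta>)"

text \<open>Writing \<open>\<xi> = dx\<^sup>i(\<xi>) X\<^sub>i + \<delta>y\<^sup>i(\<xi>) X\<^sub>\<i>\<close> in the adapted frame (horizontal \<open>X\<^sub>i\<close>, vertical \<open>X\<^sub>\<i>\<close>), the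
  following is the linear extension of \<open>X\<^sub>i \<mapsto> \<parallel>y\<parallel> X\<^sub>\<i>\<close>, \<open>X\<^sub>\<i> \<mapsto> (1/\<parallel>y\<parallel>) X\<^sub>i\<close>.\<close>

definition Q_tilde_local ::
    "'p set \<Rightarrow> ('p, real^'n) chart set \<Rightarrow>
     ('p \<Rightarrow> ('p, real^'n) tvec \<Rightarrow> ('p, real^'n) tvec \<Rightarrow> real) \<Rightarrow> ('p, real^'n) chart \<Rightarrow>
     ('p, real^'n) tpoint \<Rightarrow> ('p, real^'n) ttvec \<Rightarrow> ('p, real^'n) ttvec" where
  "Q_tilde_local M A g c q \<xi> = (\<lambda>C.
     (\<Sum>i\<in>UNIV. dx M A c i \<xi> *\<^sub>R (fibre_norm A g c q *\<^sub>R vert_frame M A c i q C)) +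
     (\<Sum>i\<in>UNIV. delta_y M A g c i q \<xi> *\<^sub>R ((1 / fibre_norm A g c q) *\<^sub>R hor_frame M A g c i q C)))"

definition Q_tilde ::
    "'p set \<Rightarrow> ('p, real^'n) chart set \<Rightarrow>
     ('p \<Rightarrow> ('p, real^'n) tvec \<Rightarrow> ('p, real^'n) tvec \<Rightarrow> real) \<Rightarrow>
     ('p, real^'n) tpoint \<Rightarrow> ('p, real^'n) ttvec \<Rightarrow> ('p, real^'n) ttvec" where
  "Q_tilde M A g q \<xi> =
     (THE \<zeta>. \<forall>c\<in>A. fst q \<in> chart_dom c \<longrightarrow> \<zeta> = Q_tilde_local M A g c q \<xi>)"

end

theory Submission
  imports Defs
begin

text \<open>Everything reduces to the fact that both tensors do not depend on the chart. In the chart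
  induced by \<open>c\<close>, a tangent vector at \<open>(p, y)\<close> has components \<open>(u, w)\<close>; its horizontal part is \<open>u\<close> and
  its vertical part is \<open>w + \<Gamma>(y, u)\<close>. A change of charts \<open>\<tau>\<close> with Jacobian \<open>J\<close> sends \<open>(u, w)\<close> to
  \<open>(J u, J w + D\<^sup>2\<tau>(u, y))\<close>, so both parts transform by \<open>J\<close> exactly if
  \<open>J \<Gamma>(u, v) = D\<^sup>2\<tau>(u, v) + \<Gamma>'(J u, J v)\<close>. This law follows by differentiating
  \<open>g(u, v) = g'(J u, J v)\<close>, inserting the result into the Koszul formula and using that \<open>D\<^sup>2\<tau>\<close> is
  symmetric and \<open>g'\<close> nondegenerate. In terms of the two parts, \<open>Q\<close> is
  \<open>(H, V) \<mapsto> (V / \<parallel>y\<parallel>, \<parallel>y\<parallel> H)\<close> and \<open>h\<close> is \<open>- 2 g(H, H') + 2 g(V, V') / \<parallel>y\<parallel>\<^sup>2\<close>, from which the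
  algebraic identities are immediate.\<close>

section \<open>Smooth functions\<close>

text \<open>\<open>h_J\<close> and \<open>Q_tilde\<close> are definite descriptions over all charts
  around the base point, so nothing can be said about them until the local expressions are shown to
  agree; chart independence is the entry to every other claim. The obstacle is the second derivative
  of the transition map: the coordinate components of a vector in the fibre direction do not
  transform by the Jacobian, and the Christoffel term in \<open>delta_y\<close> is what compensates.
  Koszul's combination is the right one to isolate this second derivative: of its six
  second-derivative terms four cancel and the other two coincide. The weights of the metric are
  matched to \<open>Q_tilde\<close>: swapping the two parts, with factors that are inverse to each
  other, turns the coefficient 2 / norm^2 into 2 and -2 into -2 / norm^2. Removing the zero section
  keeps the norm positive, so that its square root and reciprocal are smooth. As
  \<open>Ck_on\<close> differentiates along fixed directions, a derivative applied to a varying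
  direction is expanded in a basis throughout.\<close>

abbreviation fd :: "('a::real_normed_vector \<Rightarrow> 'b::real_normed_vector) \<Rightarrow> 'a \<Rightarrow> 'a \<Rightarrow> 'b" where
  "fd f x \<equiv> frechet_derivative f (at x)"

lemma fd_eqI: "(f has_derivative f') (at x) \<Longrightarrow> fd f x = f'"
  by (metis frechet_derivative_at)

lemma differentiable_cong_open:
  assumes "open S" "x \<in> S" "\<And>x. x \<in> S \<Longrightarrow> f x = g x" "f differentiable (at x)"
  shows "g differentiable (at x)" "fd g x = fd f x"
proof -
  have "(f has_derivative fd f x) (at x)"
    using assms(4) by (simp add: frechet_derivative_works)
  then have "(g has_derivative fd f x) (at x)"
    by (rule has_derivative_transform_within_open) (use assms in auto)
  then show "g differentiable (at x)" "fd g x = fd f x"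
    by (auto simp: differentiable_def fd_eqI)
qed

text \<open>Differentiability is not assumed: \<open>frechet_derivative\<close> is a choice from the
  set of derivatives, and functions that agree near \<open>x\<close> have the same such set
  there.\<close>

lemma fd_cong_open:
  assumes "open S" "x \<in> S" "\<And>x. x \<in> S \<Longrightarrow> f x = g x"
  shows "fd g x = fd f x"
proof -
  have "(f has_derivative D) (at x) \<longleftrightarrow> (g has_derivative D) (at x)" for D
    using assms has_derivative_transform_within_open[of _ D x UNIV S]
    by (metis (no_types, lifting))
  then show ?thesis
    by (simp add: frechet_derivative_def)
qed

section \<open>Calculus of k times continuously differentiable maps\<close>

lemma Ck_on_cong:
  assumes "open S" "\<And>x. x \<in> S \<Longrightarrow> f x = g x" "Ck_on k f S"
  shows "Ck_on k g S"
  using assms(2,3)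
proof (induction k arbitrary: f g)
  case 0
  then show ?case by (simp cong: continuous_on_cong)
next
  case (Suc k)
  show ?case
    unfolding Ck_on.simps
  proof (intro conjI ballI allI)
    show "g differentiable (at x)" if "x \<in> S" for x
      using differentiable_cong_open[OF assms(1) that, of f g] Suc.prems that by auto
    show "Ck_on k (\<lambda>x. fd g x v) S" for v
      by (rule Suc.IH[of "\<lambda>x. fd f x v"])
        (use Suc.prems fd_cong_open[OF assms(1), of _ f g] in auto)
  qed
qed

text \<open>Lets each closure proof below work with an explicit derivative formula instead of the
  chosen \<open>frechet_derivative\<close>.\<close>

lemma Ck_on_SucI:
  assumes "open S" "\<And>x. x \<in> S \<Longrightarrow> (f has_derivative f' x) (at x)" "\<And>v. Ck_on k (\<lambda>x. f' x v) S"
  shows "Ck_on (Suc k) f S"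
  unfolding Ck_on.simps
proof (intro conjI ballI allI)
  show "f differentiable (at x)" if "x \<in> S" for x
    using assms(2)[OF that] by (auto simp: differentiable_def)
  show "Ck_on k (\<lambda>x. fd f x v) S" for v
    by (rule Ck_on_cong[OF assms(1) _ assms(3)[of v]]) (simp add: fd_eqI[OF assms(2)])
qed

lemma Ck_on_SucD: "Ck_on (Suc k) f S \<Longrightarrow> Ck_on k f S"
proof (induction k arbitrary: f)
  case 0
  then show ?case
    by (auto intro!: continuous_at_imp_continuous_on differentiable_imp_continuous_within)
next
  case (Suc k)
  then show ?case
    by (metis Ck_on.simps(2))
qed

lemma Ck_on_Suc_has_derivative:
  "Ck_on (Suc k) f S \<Longrightarrow> x \<in> S \<Longrightarrow> (f has_derivative fd f x) (at x)"
  by (simp add: frechet_derivative_works)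

lemma Ck_on_const: "open S \<Longrightarrow> Ck_on k (\<lambda>x. c) S"
proof (induction k arbitrary: c)
  case (Suc k)
  then show ?case
    by (intro Ck_on_SucI[where f' = "\<lambda>_ _. 0"]) auto
qed auto

lemma Ck_on_bounded_linear:
  assumes "open S" "bounded_linear L" "Ck_on k f S"
  shows "Ck_on k (\<lambda>x. L (f x)) S"
  using assms(3)
proof (induction k arbitrary: f)
  case 0
  then show ?case
    using bounded_linear.continuous_on[OF assms(2)] by auto
next
  case (Suc k)
  show ?case
    by (rule Ck_on_SucI[OF assms(1),
          OF bounded_linear.has_derivative[OF assms(2) Ck_on_Suc_has_derivative[OF Suc.prems]]])
      (use Suc in auto)
qed

lemma Ck_on_add:
  assumes "open S" "Ck_on k f S" "Ck_on k g S"
  shows "Ck_on k (\<lambda>x. f x + g x) S"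
  using assms(2,3)
proof (induction k arbitrary: f g)
  case 0
  then show ?case by (auto intro: continuous_on_add)
next
  case (Suc k)
  show ?case
    by (rule Ck_on_SucI[OF assms(1),
          OF has_derivative_add[OF Suc.prems[THEN Ck_on_Suc_has_derivative]]])
      (use Suc in auto)
qed

lemma Ck_on_bilinear:
  assumes "open S" "bounded_bilinear b" "Ck_on k f S" "Ck_on k g S"
  shows "Ck_on k (\<lambda>x. b (f x) (g x)) S"
  using assms(3,4)
proof (induction k arbitrary: f g)
  case 0
  then show ?case
    using bounded_bilinear.continuous_on[OF assms(2)] by auto
next
  case (Suc k)
  show ?case
  proof (rule Ck_on_SucI[OF assms(1),
          OF bounded_bilinear.FDERIV[OF assms(2) Suc.prems[THEN Ck_on_Suc_has_derivative]]])
    fix v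
    \<comment> \<open>Each Leibniz term pairs a derivative with an undifferentiated factor, so the
      factors themselves are also needed at order \<open>k\<close>.\<close>
    have "Ck_on k (\<lambda>x. fd f x v) S" "Ck_on k (\<lambda>x. fd g x v) S" "Ck_on k f S" "Ck_on k g S"
      using Suc.prems Suc.prems[THEN Ck_on_SucD] by auto
    then show "Ck_on k (\<lambda>x. b (f x) (fd g x v) + b (fd f x v) (g x)) S"
      by (intro Ck_on_add[OF assms(1)] Suc.IH)
  qed
qed

lemma Ck_on_sum:
  assumes "open S" "\<And>i. i \<in> I \<Longrightarrow> Ck_on k (f i) S"
  shows "Ck_on k (\<lambda>x. \<Sum>i\<in>I. f i x) S"
  using assms(2)
  by (induction I rule: infinite_finite_induct) (auto intro: Ck_on_const Ck_on_add assms(1))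

lemma linear_euclidean_expansion:
  fixes L :: "'a::euclidean_space \<Rightarrow> 'b::real_vector"
  assumes "linear L"
  shows "L v = (\<Sum>b\<in>Basis. (v \<bullet> b) *\<^sub>R L b)"
proof -
  have "L v = L (\<Sum>b\<in>Basis. (v \<bullet> b) *\<^sub>R b)"
    by (simp add: euclidean_representation)
  also have "\<dots> = (\<Sum>b\<in>Basis. (v \<bullet> b) *\<^sub>R L b)"
    by (simp add: linear_sum[OF assms] linear_cmul[OF assms])
  finally show ?thesis .
qed

text \<open>The chain rule produces \<open>fd f (g x)\<close> in the direction
  \<open>fd g x v\<close>, which varies with \<open>x\<close>, while \<open>Ck_on\<close> only
  controls fixed directions. Expanding that direction in the basis leaves products of a scalar with
  \<open>fd f (g x) b\<close> for fixed \<open>b\<close>, and to the latter the induction hypothesis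
  applies.\<close>

lemma Ck_on_compose:
  assumes "open S" "open T" "g ` S \<subseteq> T" "Ck_on k f T" "Ck_on k g S"
  shows "Ck_on k (\<lambda>x. f (g x)) S"
  using assms(4,5)
proof (induction k arbitrary: f)
  case 0
  then show ?case
    using continuous_on_compose2[OF _ _ assms(3)] by auto
next
  case (Suc k)
  have D: "(f has_derivative fd f (g x)) (at (g x))" if "x \<in> S" for x
    using assms(3) that by (intro Ck_on_Suc_has_derivative[OF Suc.prems(1)]) auto
  have "((\<lambda>x. f (g x)) has_derivative (\<lambda>v. \<Sum>b\<in>Basis. (fd g x v \<bullet> b) *\<^sub>R fd f (g x) b)) (at x)"
    if "x \<in> S" for x
  proof -
    have "((\<lambda>x. f (g x)) has_derivative (\<lambda>v. fd f (g x) (fd g x v))) (at x)"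
      using diff_chain_at[OF Ck_on_Suc_has_derivative[OF Suc.prems(2) that] D[OF that]]
      by (simp add: o_def)
    moreover have "(\<lambda>v. fd f (g x) (fd g x v)) =
        (\<lambda>v. \<Sum>b\<in>Basis. (fd g x v \<bullet> b) *\<^sub>R fd f (g x) b)"
      by (intro ext linear_euclidean_expansion has_derivative_linear[OF D[OF that]])
    ultimately show ?thesis by (simp only:)
  qed
  then show ?case
  proof (rule Ck_on_SucI[OF assms(1)])
    fix v
    have "Ck_on k (\<lambda>x. fd f (g x) b) S" for b
      using Suc.IH[of "\<lambda>x. fd f x b"] Suc.prems Ck_on_SucD[OF Suc.prems(2)] by auto
    moreover have "Ck_on k (\<lambda>x. fd g x v \<bullet> b) S" for b
      using Suc.prems(2) by (intro Ck_on_bounded_linear[OF assms(1) bounded_linear_inner_left]) auto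
    ultimately show "Ck_on k (\<lambda>x. \<Sum>b\<in>Basis. (fd g x v \<bullet> b) *\<^sub>R fd f (g x) b) S"
      by (intro Ck_on_sum[OF assms(1)] Ck_on_bilinear[OF assms(1) bounded_bilinear_scaleR])
  qed
qed

lemma Ck_on_ident: "open S \<Longrightarrow> Ck_on k (\<lambda>x. x) S"
proof (cases k)
  case (Suc k)
  then show "open S \<Longrightarrow> ?thesis"
    by (auto intro!: Ck_on_SucI[where f' = "\<lambda>_ v. v"] Ck_on_const simp: has_derivative_ident)
qed auto

text \<open>The derivative is a polynomial in \<open>inverse\<close> itself, so order
  \<open>k\<close> of the function gives order \<open>k\<close> of its derivative.\<close>

lemma Ck_on_inverse: "Ck_on k (inverse :: real \<Rightarrow> real) (- {0})"
proof (induction k)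
  case 0
  then show ?case by (auto intro: continuous_on_inverse)
next
  case (Suc k)
  have S: "open (- {0::real})" by auto
  show ?case
  proof (rule Ck_on_SucI[OF S])
    fix v
    have "Ck_on k (\<lambda>x::real. (- v) * (inverse x * inverse x)) (- {0})"
      by (intro Ck_on_bilinear[OF S bounded_bilinear_mult] Suc Ck_on_const S)
    then show "Ck_on k (\<lambda>x::real. - (inverse x * v * inverse x)) (- {0})"
      by (rule Ck_on_cong[OF S, rotated]) auto
  qed (rule has_derivative_inverse', auto)
qed

text \<open>The same bootstrapping as for \<open>inverse\<close>: the derivative is half the
  reciprocal of \<open>sqrt\<close>.\<close>

lemma Ck_on_sqrt: "Ck_on k sqrt {0<..}"
proof (induction k)
  case 0
  then show ?case by (auto intro: continuous_on_real_sqrt)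
next
  case (Suc k)
  have S: "open {0::real<..}" by auto
  show ?case
  proof (rule Ck_on_SucI[OF S])
    fix v
    show "Ck_on k (\<lambda>x::real. v * (inverse (sqrt x) * (1/2))) {0<..}"
      by (intro Ck_on_bilinear[OF S bounded_bilinear_mult] Ck_on_const S
          Ck_on_compose[OF S _ _ Ck_on_inverse Suc]) auto
    show "(sqrt has_derivative (\<lambda>v. v * (inverse (sqrt x) * (1/2)))) (at x)" if "x \<in> {0<..}" for x
    proof -
      have "(sqrt has_derivative (*) (inverse (sqrt x) / 2)) (at x)"
        using DERIV_real_sqrt[of x] that by (simp add: has_field_derivative_def)
      moreover have "(*) (inverse (sqrt x) / 2) = (\<lambda>v. v * (inverse (sqrt x) * (1/2)))"
        by (auto simp: fun_eq_iff)
      ultimately show ?thesis by simp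
    qed
  qed
qed

section \<open>Closure properties of smooth maps\<close>

lemma smooth_on_cong:
  "open S \<Longrightarrow> (\<And>x. x \<in> S \<Longrightarrow> f x = g x) \<Longrightarrow> smooth_on f S \<Longrightarrow> smooth_on g S"
  by (metis Ck_on_cong smooth_on_def)

lemma smooth_on_continuous_on: "smooth_on f S \<Longrightarrow> continuous_on S f"
  by (metis Ck_on.simps(1) smooth_on_def)

lemma smooth_on_has_derivative:
  "smooth_on f S \<Longrightarrow> x \<in> S \<Longrightarrow> (f has_derivative fd f x) (at x)"
  by (metis Ck_on_Suc_has_derivative smooth_on_def)

lemma smooth_on_linear_fd: "smooth_on f S \<Longrightarrow> x \<in> S \<Longrightarrow> linear (fd f x)"
  by (metis has_derivative_linear smooth_on_has_derivative)

lemma smooth_on_fd: "smooth_on f S \<Longrightarrow> smooth_on (\<lambda>x. fd f x v) S"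
  by (metis Ck_on.simps(2) smooth_on_def)

lemma smooth_on_const: "open S \<Longrightarrow> smooth_on (\<lambda>x. c) S"
  by (simp add: smooth_on_def Ck_on_const)

lemma smooth_on_ident: "open S \<Longrightarrow> smooth_on (\<lambda>x. x) S"
  by (simp add: smooth_on_def Ck_on_ident)

lemma smooth_on_bounded_linear:
  "open S \<Longrightarrow> bounded_linear L \<Longrightarrow> smooth_on f S \<Longrightarrow> smooth_on (\<lambda>x. L (f x)) S"
  by (simp add: smooth_on_def Ck_on_bounded_linear)

lemma smooth_on_bilinear:
  "open S \<Longrightarrow> bounded_bilinear b \<Longrightarrow> smooth_on f S \<Longrightarrow> smooth_on g S \<Longrightarrow>
    smooth_on (\<lambda>x. b (f x) (g x)) S"
  by (simp add: smooth_on_def Ck_on_bilinear)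

lemma smooth_on_compose:
  "open S \<Longrightarrow> open T \<Longrightarrow> g ` S \<subseteq> T \<Longrightarrow> smooth_on f T \<Longrightarrow> smooth_on g S \<Longrightarrow> smooth_on (\<lambda>x. f (g x)) S"
  by (simp add: smooth_on_def Ck_on_compose)

lemma smooth_on_add:
  "open S \<Longrightarrow> smooth_on f S \<Longrightarrow> smooth_on g S \<Longrightarrow> smooth_on (\<lambda>x. f x + g x) S"
  by (simp add: smooth_on_def Ck_on_add)

lemma smooth_on_sum:
  "open S \<Longrightarrow> (\<And>i. i \<in> I \<Longrightarrow> smooth_on (f i) S) \<Longrightarrow> smooth_on (\<lambda>x. \<Sum>i\<in>I. f i x) S"
  by (simp add: smooth_on_def Ck_on_sum)

lemma smooth_on_scaleR:
  "open S \<Longrightarrow> smooth_on f S \<Longrightarrow> smooth_on g S \<Longrightarrow> smooth_on (\<lambda>x. f x *\<^sub>R g x) S"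
  by (rule smooth_on_bilinear[OF _ bounded_bilinear_scaleR])

lemma smooth_on_mult:
  fixes f g :: "'a::euclidean_space \<Rightarrow> real"
  shows "open S \<Longrightarrow> smooth_on f S \<Longrightarrow> smooth_on g S \<Longrightarrow> smooth_on (\<lambda>x. f x * g x) S"
  by (rule smooth_on_bilinear[OF _ bounded_bilinear_mult])

lemma smooth_on_prod:
  fixes f :: "'i \<Rightarrow> 'a::euclidean_space \<Rightarrow> real"
  assumes "open S" "\<And>i. i \<in> I \<Longrightarrow> smooth_on (f i) S"
  shows "smooth_on (\<lambda>x. \<Prod>i\<in>I. f i x) S"
  using assms(2)
  by (induction I rule: infinite_finite_induct)
    (auto intro: smooth_on_const smooth_on_mult assms(1))

lemma smooth_on_minus:
  assumes "open S" "smooth_on f S"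
  shows "smooth_on (\<lambda>x. - f x) S"
  by (rule smooth_on_bounded_linear[OF assms(1) _ assms(2)])
    (rule bounded_linear_minus[OF bounded_linear_ident])

lemma smooth_on_diff:
  "open S \<Longrightarrow> smooth_on f S \<Longrightarrow> smooth_on g S \<Longrightarrow> smooth_on (\<lambda>x. f x - g x) S"
  using smooth_on_add[of S f "\<lambda>x. - g x"] smooth_on_minus by auto

lemma smooth_on_Pair:
  fixes f :: "'a::euclidean_space \<Rightarrow> 'b::real_normed_vector" and g :: "'a \<Rightarrow> 'c::real_normed_vector"
  assumes "open S" "smooth_on f S" "smooth_on g S"
  shows "smooth_on (\<lambda>x. (f x, g x)) S"
proof -
  have "bounded_linear (\<lambda>x::'b. (x, 0::'c))" "bounded_linear (\<lambda>x::'c. (0::'b, x))"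
    by (intro bounded_linear_Pair bounded_linear_ident bounded_linear_zero)+
  then have "smooth_on (\<lambda>x. (f x, 0) + (0, g x)) S"
    using assms by (intro smooth_on_add) (auto intro: smooth_on_bounded_linear)
  then show ?thesis by simp
qed

lemma smooth_on_inverse:
  fixes f :: "'a::euclidean_space \<Rightarrow> real"
  assumes "open S" "smooth_on f S" "\<And>x. x \<in> S \<Longrightarrow> f x \<noteq> 0"
  shows "smooth_on (\<lambda>x. inverse (f x)) S"
  by (rule smooth_on_compose[OF assms(1) _ _ _ assms(2), where T = "- {0}"])
    (use assms(3) in \<open>auto simp: smooth_on_def Ck_on_inverse\<close>)

lemma smooth_on_divide:
  fixes f :: "'a::euclidean_space \<Rightarrow> real"
  assumes "open S" "smooth_on f S" "smooth_on g S" "\<And>x. x \<in> S \<Longrightarrow> g x \<noteq> 0"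
  shows "smooth_on (\<lambda>x. f x / g x) S"
  unfolding divide_inverse using assms by (intro smooth_on_mult smooth_on_inverse)

lemma smooth_on_sqrt:
  fixes f :: "'a::euclidean_space \<Rightarrow> real"
  assumes "open S" "smooth_on f S" "\<And>x. x \<in> S \<Longrightarrow> f x > 0"
  shows "smooth_on (\<lambda>x. sqrt (f x)) S"
  by (rule smooth_on_compose[OF assms(1) _ _ _ assms(2), where T = "{0<..}"])
    (use assms(3) in \<open>auto simp: smooth_on_def Ck_on_sqrt\<close>)

text \<open>Here both the base point and the direction of the derivative vary; this is the form of
  the fibre component of a transition map of the bundle.\<close>

lemma smooth_on_fd_apply:
  fixes f :: "'a::euclidean_space \<Rightarrow> 'b::real_normed_vector" and h :: "'c::euclidean_space \<Rightarrow> 'a"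
  assumes "open S" "open T" "smooth_on f T" "smooth_on g S" "g ` S \<subseteq> T" "smooth_on h S"
  shows "smooth_on (\<lambda>x. fd f (g x) (h x)) S"
proof -
  have "smooth_on (\<lambda>x. \<Sum>b\<in>Basis. (h x \<bullet> b) *\<^sub>R fd f (g x) b) S"
    by (intro smooth_on_sum smooth_on_scaleR assms
        smooth_on_bounded_linear[OF assms(1) bounded_linear_inner_left]
        smooth_on_compose[OF assms(1,2,5) smooth_on_fd[OF assms(3)]])
  moreover have "fd f (g x) (h x) = (\<Sum>b\<in>Basis. (h x \<bullet> b) *\<^sub>R fd f (g x) b)" if "x \<in> S" for x
    using linear_euclidean_expansion[OF smooth_on_linear_fd[OF assms(3)]] assms(5) that by auto
  ultimately show ?thesis
    by (metis (no_types, lifting) smooth_on_cong[OF assms(1)])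
qed

lemma smooth_on_vec_nth:
  fixes f :: "'a::euclidean_space \<Rightarrow> real^'n"
  shows "open S \<Longrightarrow> smooth_on f S \<Longrightarrow> smooth_on (\<lambda>x. f x $ i) S"
  by (rule smooth_on_bounded_linear[OF _ bounded_linear_vec_nth])

lemma smooth_on_vec_lambda:
  fixes f :: "'n::finite \<Rightarrow> 'a::euclidean_space \<Rightarrow> real"
  assumes "open S" "\<And>i. smooth_on (f i) S"
  shows "smooth_on (\<lambda>x. \<chi> i. f i x) S"
proof -
  have "smooth_on (\<lambda>x. \<Sum>i\<in>UNIV. f i x *\<^sub>R axis i (1::real)) S"
    by (intro smooth_on_sum smooth_on_scaleR smooth_on_const assms)
  moreover have "(\<Sum>i\<in>UNIV. f i x *\<^sub>R axis i (1::real)) = (\<chi> i. f i x)" for x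
    by (auto simp: vec_eq_iff axis_def if_distrib cong: if_cong)
  ultimately show ?thesis by simp
qed

section \<open>Smooth dependence of determinants and inverse matrices\<close>

lemma smooth_on_det:
  fixes B :: "'a::euclidean_space \<Rightarrow> real^'n^'n"
  assumes "open S" "\<And>i j. smooth_on (\<lambda>x. B x $ i $ j) S"
  shows "smooth_on (\<lambda>x. det (B x)) S"
  unfolding det_def
  by (intro smooth_on_sum smooth_on_mult smooth_on_prod smooth_on_const assms)

lemma matrix_inv_right_inverse:
  fixes B :: "real^'n^'n"
  assumes "det B \<noteq> 0"
  shows "B ** matrix_inv B = mat 1"
proof -
  have "\<exists>B'. B ** B' = mat 1 \<and> B' ** B = mat 1"
    using assms by (simp add: invertible_det_nz[symmetric] invertible_def)
  then show ?thesis
    unfolding matrix_inv_def by (metis (mono_tags, lifting) someI_ex)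
qed

text \<open>\<open>matrix_inv\<close> is a choice and shows no dependence on the entries. Column
  \<open>l\<close> of the inverse solves a linear system with right side \<open>axis l 1\<close>, so
  Cramer's rule exhibits its entries as quotients of determinants, which are visibly smooth.\<close>

lemma matrix_inv_cramer:
  fixes B :: "real^'n^'n"
  assumes "det B \<noteq> 0"
  shows "matrix_inv B $ k $ l =
    det (\<chi> i j. if j = k then axis l 1 $ i else B $ i $ j) / det B"
proof -
  have "B *v (matrix_inv B *v axis l 1) = axis l 1"
    by (simp add: matrix_vector_mul_assoc matrix_inv_right_inverse assms)
  then have "(matrix_inv B *v axis l 1) $ k =
      det (\<chi> i j. if j = k then axis l 1 $ i else B $ i $ j) / det B"
    using cramer[OF assms] by simp
  then show ?thesis
    by (simp add: matrix_vector_mul_component inner_axis row_def)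
qed

lemma smooth_on_matrix_inv:
  fixes B :: "'a::euclidean_space \<Rightarrow> real^'n^'n"
  assumes S: "open S" and B: "\<And>i j. smooth_on (\<lambda>x. B x $ i $ j) S"
    and "\<And>x. x \<in> S \<Longrightarrow> det (B x) \<noteq> 0"
  shows "smooth_on (\<lambda>x. matrix_inv (B x) $ k $ l) S"
proof (rule smooth_on_cong[OF S])
  have "smooth_on (\<lambda>x. if j = k then axis l 1 $ i else B x $ i $ j) S" for i j
    by (cases "j = k") (auto intro: smooth_on_const S B)
  then show "smooth_on (\<lambda>x. det (\<chi> i j. if j = k then axis l 1 $ i else B x $ i $ j) / det (B x)) S"
    by (intro smooth_on_divide smooth_on_det S B) (auto simp: assms)
qed (simp add: matrix_inv_cramer assms)

subsection \<open>Symmetry of second derivatives\<close>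

text \<open>The mean value theorem is applied twice: to the difference of \<open>f\<close> along two
  parallel segments in direction \<open>u\<close>, then to the derivative along \<open>u\<close> as
  a function of the parameter in direction \<open>v\<close>.\<close>

lemma second_difference_mvt:
  fixes f :: "'a::euclidean_space \<Rightarrow> real"
  assumes S: "open S" and f: "smooth_on f S" and h: "0 < h"
    and sub: "\<And>s t. 0 \<le> s \<Longrightarrow> s \<le> h \<Longrightarrow> 0 \<le> t \<Longrightarrow> t \<le> h \<Longrightarrow> x + s *\<^sub>R u + t *\<^sub>R v \<in> S"
  obtains s t where "0 < s" "s < h" "0 < t" "t < h"
    "f (x + h *\<^sub>R u + h *\<^sub>R v) - f (x + h *\<^sub>R u) - f (x + h *\<^sub>R v) + f x =
      h * (h * fd (\<lambda>z. fd f z u) (x + s *\<^sub>R u + t *\<^sub>R v) v)"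
proof -
  have 1: "((\<lambda>s. F (x + s *\<^sub>R u + t *\<^sub>R v)) has_real_derivative fd F (x + s *\<^sub>R u + t *\<^sub>R v) u) (at s)"
    and 2: "((\<lambda>t. F (x + s *\<^sub>R u + t *\<^sub>R v)) has_real_derivative fd F (x + s *\<^sub>R u + t *\<^sub>R v) v) (at t)"
    if F: "smooth_on F S" and st: "0 \<le> s" "s \<le> h" "0 \<le> t" "t \<le> h" for F :: "'a \<Rightarrow> real" and s t
  proof -
    have D: "(F has_derivative fd F (x + s *\<^sub>R u + t *\<^sub>R v)) (at (x + s *\<^sub>R u + t *\<^sub>R v))"
      by (rule smooth_on_has_derivative[OF F sub[OF st]])
    have lin: "fd F y (d *\<^sub>R w) = fd F y w * d" if "y \<in> S" for d w y
      using linear_cmul[OF smooth_on_linear_fd[OF F that]] by (simp add: mult.commute)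
    have a: "((\<lambda>s. x + s *\<^sub>R u + t *\<^sub>R v) has_derivative (\<lambda>d. d *\<^sub>R u)) (at s)"
      "((\<lambda>t. x + s *\<^sub>R u + t *\<^sub>R v) has_derivative (\<lambda>d. d *\<^sub>R v)) (at t)"
      by (auto intro!: derivative_eq_intros)
    show "((\<lambda>s. F (x + s *\<^sub>R u + t *\<^sub>R v)) has_real_derivative fd F (x + s *\<^sub>R u + t *\<^sub>R v) u) (at s)"
      "((\<lambda>t. F (x + s *\<^sub>R u + t *\<^sub>R v)) has_real_derivative fd F (x + s *\<^sub>R u + t *\<^sub>R v) v) (at t)"
      using diff_chain_at[OF a(1) D] diff_chain_at[OF a(2) D] lin[OF sub[OF st]]
      by (auto simp: has_field_derivative_def o_def)
  qed
  \<comment> \<open>The summand \<open>0 *\<^sub>R v\<close> makes both terms instances of the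
    derivative fact \<open>1\<close>, with \<open>t = h\<close> and \<open>t = 0\<close>.\<close>
  define \<phi> where "\<phi> s = f (x + s *\<^sub>R u + h *\<^sub>R v) - f (x + s *\<^sub>R u + 0 *\<^sub>R v)" for s
  have D: "(\<phi> has_real_derivative fd f (x + s *\<^sub>R u + h *\<^sub>R v) u - fd f (x + s *\<^sub>R u + 0 *\<^sub>R v) u) (at s)"
    if "0 \<le> s" "s \<le> h" for s
    unfolding \<phi>_def by (intro DERIV_diff 1[OF f that]) (use h in auto)
  obtain s where s: "0 < s" "s < h"
    "\<phi> h - \<phi> 0 = (h - 0) * (fd f (x + s *\<^sub>R u + h *\<^sub>R v) u - fd f (x + s *\<^sub>R u + 0 *\<^sub>R v) u)"
    using MVT2[OF h D] by blast
  obtain t where t: "0 < t" "t < h"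
    "fd f (x + s *\<^sub>R u + h *\<^sub>R v) u - fd f (x + s *\<^sub>R u + 0 *\<^sub>R v) u
      = (h - 0) * fd (\<lambda>z. fd f z u) (x + s *\<^sub>R u + t *\<^sub>R v) v"
    using MVT2[OF h 2[OF smooth_on_fd[OF f, of u], of s]] s by auto
  show ?thesis
    by (rule that[of s t]) (use s t in \<open>auto simp: \<phi>_def\<close>)
qed

text \<open>The second difference over a small parallelogram is symmetric in \<open>u\<close> and
  \<open>v\<close>. It therefore forces a value of one mixed derivative near \<open>x\<close> to
  equal a value of the other near \<open>x\<close>, which by continuity is impossible if they differ
  at \<open>x\<close>.\<close>

lemma second_derivative_symmetric_real:
  fixes f :: "'a::euclidean_space \<Rightarrow> real"
  assumes S: "open S" and f: "smooth_on f S" and x: "x \<in> S"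
  shows "fd (\<lambda>z. fd f z u) x v = fd (\<lambda>z. fd f z v) x u"
proof (rule ccontr)
  define a where "a z = fd (\<lambda>z. fd f z u) z v" for z
  define b where "b z = fd (\<lambda>z. fd f z v) z u" for z
  assume "fd (\<lambda>z. fd f z u) x v \<noteq> fd (\<lambda>z. fd f z v) x u"
  \<comment> \<open>Half the gap: a number that is closer than this to \<open>a x\<close> cannot
    also be that close to \<open>b x\<close>.\<close>
  then have e: "\<bar>a x - b x\<bar> / 2 > 0" (is "?e > 0") by (simp add: a_def b_def)
  have "isCont a x" "isCont b x"
    using S x smooth_on_continuous_on[OF smooth_on_fd[OF smooth_on_fd[OF f]]]
    by (auto simp: a_def[abs_def] b_def[abs_def] continuous_on_eq_continuous_at)
  then obtain d1 d2 where d: "d1 > 0" "d2 > 0"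
    "\<And>y. dist y x < d1 \<Longrightarrow> dist (a y) (a x) < ?e" "\<And>y. dist y x < d2 \<Longrightarrow> dist (b y) (b x) < ?e"
    using e unfolding continuous_at_eps_delta by metis
  obtain d3 where d3: "d3 > 0" "\<And>y. dist y x < d3 \<Longrightarrow> y \<in> S"
    using S x unfolding open_dist by metis
  define r where "r = min d1 (min d2 d3)"
  have r: "r > 0" using d d3 by (simp add: r_def)
  \<comment> \<open>Keeps the parallelogram spanned by \<open>h *\<^sub>R u\<close> and
    \<open>h *\<^sub>R v\<close> inside the ball of radius \<open>r\<close>; the 1 keeps the
    denominator positive when both vectors vanish.\<close>
  define h where "h = r / (norm u + norm v + 1)"
  have N: "norm u + norm v + 1 > 0" by (smt (verit) norm_ge_zero)
  have h: "h > 0" unfolding h_def by (intro divide_pos_pos r N)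
  have near: "dist (x + s *\<^sub>R u + t *\<^sub>R v) x < r"
    if "0 \<le> s" "s \<le> h" "0 \<le> t" "t \<le> h" for s t
  proof -
    have "dist (x + s *\<^sub>R u + t *\<^sub>R v) x = norm (s *\<^sub>R u + t *\<^sub>R v)"
      by (simp add: dist_norm algebra_simps)
    also have "\<dots> \<le> s * norm u + t * norm v"
      using norm_triangle_ineq[of "s *\<^sub>R u" "t *\<^sub>R v"] that by simp
    also have "\<dots> \<le> h * norm u + h * norm v"
      by (intro add_mono mult_right_mono that) auto
    also have "\<dots> < h * (norm u + norm v + 1)"
      using h by (simp add: algebra_simps)
    also have "\<dots> = r" using N by (simp add: h_def)
    finally show ?thesis .
  qed
  have sub: "x + s *\<^sub>R u + t *\<^sub>R v \<in> S" "x + s *\<^sub>R v + t *\<^sub>R u \<in> S"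
    if "0 \<le> s" "s \<le> h" "0 \<le> t" "t \<le> h" for s t
    using near[of s t] near[of t s] that d3(2) by (auto simp: r_def add_ac)
  obtain s t where st: "0 < s" "s < h" "0 < t" "t < h"
    "f (x + h *\<^sub>R u + h *\<^sub>R v) - f (x + h *\<^sub>R u) - f (x + h *\<^sub>R v) + f x =
      h * (h * a (x + s *\<^sub>R u + t *\<^sub>R v))"
    by (rule second_difference_mvt[OF S f h sub(1), folded a_def])
  \<comment> \<open>The roles of \<open>u\<close> and \<open>v\<close> are exchanged; the left side
    is the same second difference.\<close>
  obtain s' t' where st': "0 < s'" "s' < h" "0 < t'" "t' < h"
    "f (x + h *\<^sub>R v + h *\<^sub>R u) - f (x + h *\<^sub>R v) - f (x + h *\<^sub>R u) + f x =
      h * (h * b (x + s' *\<^sub>R v + t' *\<^sub>R u))"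
    by (rule second_difference_mvt[OF S f h sub(2), folded b_def])
  have c: "x + p + q = x + q + p" for p q :: 'a
    by (simp add: add_ac)
  have "h * (h * a (x + s *\<^sub>R u + t *\<^sub>R v)) = h * (h * b (x + t' *\<^sub>R u + s' *\<^sub>R v))"
    using st(5) st'(5)[unfolded c[of "h *\<^sub>R v" "h *\<^sub>R u"] c[of "s' *\<^sub>R v" "t' *\<^sub>R u"]]
    by linarith
  then have eq: "a (x + s *\<^sub>R u + t *\<^sub>R v) = b (x + t' *\<^sub>R u + s' *\<^sub>R v)"
    using h by simp
  have "dist (a (x + s *\<^sub>R u + t *\<^sub>R v)) (a x) < ?e" "dist (b (x + t' *\<^sub>R u + s' *\<^sub>R v)) (b x) < ?e"
    using near[of s t] near[of t' s'] st st' d(3,4) by (auto simp: r_def)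
  then show False
    using eq by (auto simp: dist_real_def abs_if split: if_splits)
qed

text \<open>The mean value argument is scalar, so the claim is reduced to the components
  \<open>f z \<bullet> b\<close>.\<close>

lemma second_derivative_symmetric:
  fixes f :: "'a::euclidean_space \<Rightarrow> 'b::euclidean_space"
  assumes S: "open S" and f: "smooth_on f S" and x: "x \<in> S"
  shows "fd (\<lambda>z. fd f z u) x v = fd (\<lambda>z. fd f z v) x u"
proof (rule euclidean_eqI)
  fix b :: 'b
  have fb: "smooth_on (\<lambda>z. f z \<bullet> b) S"
    by (rule smooth_on_bounded_linear[OF S bounded_linear_inner_left f])
  have in1: "fd (\<lambda>z. F z \<bullet> b) z w = fd F z w \<bullet> b" if "smooth_on F S" "z \<in> S" for F :: "'a \<Rightarrow> 'b" and z w
    using bounded_linear.has_derivative[OF bounded_linear_inner_left smooth_on_has_derivative[OF that]]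
    by (metis fd_eqI)
  have in2: "fd (\<lambda>z. fd f z w) x w' \<bullet> b = fd (\<lambda>z. fd (\<lambda>z. f z \<bullet> b) z w) x w'" for w w'
  proof -
    have "fd (\<lambda>z. fd (\<lambda>z. f z \<bullet> b) z w) x = fd (\<lambda>z. fd f z w \<bullet> b) x"
      by (rule fd_cong_open[OF S x]) (simp add: in1 f)
    then show ?thesis
      using in1[OF smooth_on_fd[OF f] x] by simp
  qed
  show "fd (\<lambda>z. fd f z u) x v \<bullet> b = fd (\<lambda>z. fd f z v) x u \<bullet> b"
    unfolding in2 by (rule second_derivative_symmetric_real[OF S fb x])
qed

section \<open>Charts, tangent vectors and the topology of an atlas\<close>

locale atlas =
  fixes M :: "'p set" and A :: "('p, 'e::euclidean_space) chart set"
  assumes smooth_atlas: "smooth_atlas M A"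
begin

abbreviation overlap :: "('p, 'e) chart \<Rightarrow> ('p, 'e) chart \<Rightarrow> 'e set" where
  "overlap c d \<equiv> chart_map c ` (chart_dom c \<inter> chart_dom d)"

abbreviation jac :: "('p, 'e) chart \<Rightarrow> ('p, 'e) chart \<Rightarrow> 'p \<Rightarrow> 'e \<Rightarrow> 'e" where
  "jac c d p \<equiv> fd (transition c d) (chart_map c p)"

lemma M_eq: "M = (\<Union>c\<in>A. chart_dom c)"
  using smooth_atlas by (simp add: smooth_atlas_def)

lemma chart_exists: "p \<in> M \<Longrightarrow> \<exists>c\<in>A. p \<in> chart_dom c"
  using M_eq by auto

lemma inj_chart: "c \<in> A \<Longrightarrow> inj_on (chart_map c) (chart_dom c)"
  using smooth_atlas by (simp add: smooth_atlas_def)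

lemma open_overlap: "c \<in> A \<Longrightarrow> d \<in> A \<Longrightarrow> open (overlap c d)"
  using smooth_atlas by (simp add: smooth_atlas_def)

lemma open_chart_image: "c \<in> A \<Longrightarrow> open (chart_map c ` chart_dom c)"
  using open_overlap[of c c] by simp

lemma smooth_transition: "c \<in> A \<Longrightarrow> d \<in> A \<Longrightarrow> smooth_on (transition c d) (overlap c d)"
  using smooth_atlas by (simp add: smooth_atlas_def)

lemma chart_inv_map [simp]: "c \<in> A \<Longrightarrow> p \<in> chart_dom c \<Longrightarrow> chart_inv c (chart_map c p) = p"
  by (simp add: chart_inv_def inj_chart)

lemma transition_map [simp]:
  "c \<in> A \<Longrightarrow> p \<in> chart_dom c \<Longrightarrow> transition c d (chart_map c p) = chart_map d p"
  by (simp add: transition_def)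

lemma transition_has_derivative:
  "c \<in> A \<Longrightarrow> d \<in> A \<Longrightarrow> p \<in> chart_dom c \<Longrightarrow> p \<in> chart_dom d \<Longrightarrow>
    (transition c d has_derivative jac c d p) (at (chart_map c p))"
  by (rule smooth_on_has_derivative[OF smooth_transition]) auto

lemma linear_jac:
  "c \<in> A \<Longrightarrow> d \<in> A \<Longrightarrow> p \<in> chart_dom c \<Longrightarrow> p \<in> chart_dom d \<Longrightarrow> linear (jac c d p)"
  by (rule has_derivative_linear[OF transition_has_derivative])

text \<open>The chain rule, applied on the part of the domain where the direct transition coincides
  with the composite one.\<close>

lemma jac_cocycle:
  assumes "c \<in> A" "d \<in> A" "e \<in> A" "p \<in> chart_dom c" "p \<in> chart_dom d" "p \<in> chart_dom e"
  shows "jac d e p (jac c d p v) = jac c e p v"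
proof -
  define S where "S = overlap c d \<inter> overlap c e"
  have S: "open S" "chart_map c p \<in> S"
    using assms by (auto simp: S_def intro!: open_Int open_overlap)
  have eq: "transition c e x = transition d e (transition c d x)" if "x \<in> S" for x
  proof -
    have "x \<in> overlap c d"
      using that by (simp add: S_def)
    then obtain q where "q \<in> chart_dom c" "q \<in> chart_dom d" "x = chart_map c q"
      by blast
    then show ?thesis using assms by simp
  qed
  have "((\<lambda>x. transition d e (transition c d x)) has_derivative (\<lambda>v. jac d e p (jac c d p v)))
      (at (chart_map c p))"
    using diff_chain_at[OF transition_has_derivative[of c d p], of "transition d e" "jac d e p"]
      transition_has_derivative[of d e p] assms by (simp add: o_def)
  then have "fd (\<lambda>x. transition d e (transition c d x)) (chart_map c p) =
      (\<lambda>v. jac d e p (jac c d p v))"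
    by (rule fd_eqI)
  moreover have "fd (transition c e) (chart_map c p) =
      fd (\<lambda>x. transition d e (transition c d x)) (chart_map c p)"
    by (rule fd_cong_open[OF S]) (simp add: eq)
  ultimately show ?thesis by simp
qed

lemma jac_self [simp]:
  assumes "c \<in> A" "p \<in> chart_dom c"
  shows "jac c c p v = v"
proof -
  have "fd (transition c c) (chart_map c p) = fd (\<lambda>x. x) (chart_map c p)"
    by (rule fd_cong_open[OF open_chart_image[OF assms(1)]]) (use assms in auto)
  then show ?thesis by simp
qed

lemma coord_vec_apply:
  "coord_vec A c p e d = (if d \<in> A \<and> p \<in> chart_dom d then jac c d p e else 0)"
  by (simp add: coord_vec_def)

lemma coord_vec_self [simp]: "c \<in> A \<Longrightarrow> p \<in> chart_dom c \<Longrightarrow> coord_vec A c p e c = e"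
  by (simp add: coord_vec_apply)

lemma coord_vec_tangent:
  "c \<in> A \<Longrightarrow> p \<in> chart_dom c \<Longrightarrow> coord_vec A c p e \<in> tangent_space A p"
  by (auto simp: tangent_space_def coord_vec_apply jac_cocycle)

lemma tangent_jac:
  assumes "v \<in> tangent_space A p" "c \<in> A" "p \<in> chart_dom c" "d \<in> A" "p \<in> chart_dom d"
  shows "v d = jac c d p (v c)"
  using assms unfolding tangent_space_def by blast

text \<open>One component determines the whole function: the Jacobians give the values at the other
  charts around \<open>p\<close>, and the normalisation to 0 gives all remaining ones.\<close>

lemma tangent_eq_coord_vec:
  assumes "v \<in> tangent_space A p" "c \<in> A" "p \<in> chart_dom c"
  shows "v = coord_vec A c p (v c)"
proof
  fix d
  show "v d = coord_vec A c p (v c) d"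
  proof (cases "d \<in> A \<and> p \<in> chart_dom d")
    case True
    then show ?thesis
      using tangent_jac[OF assms, of d] by (simp add: coord_vec_apply)
  next
    case False
    then have "v d = 0"
      using assms(1) unfolding tangent_space_def by blast
    then show ?thesis
      using False by (auto simp: coord_vec_apply)
  qed
qed

lemma tangent_eqI:
  "u \<in> tangent_space A p \<Longrightarrow> v \<in> tangent_space A p \<Longrightarrow> c \<in> A \<Longrightarrow> p \<in> chart_dom c \<Longrightarrow>
    u c = v c \<Longrightarrow> u = v"
  by (metis (no_types) tangent_eq_coord_vec[of u p c] tangent_eq_coord_vec[of v p c])

lemma coord_vec_combine:
  assumes "c \<in> A" "p \<in> chart_dom c"
  shows "coord_vec A c p (a *\<^sub>R u + b *\<^sub>R v) =
    (\<lambda>d. a *\<^sub>R coord_vec A c p u d + b *\<^sub>R coord_vec A c p v d)"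
proof
  fix d
  show "coord_vec A c p (a *\<^sub>R u + b *\<^sub>R v) d =
      a *\<^sub>R coord_vec A c p u d + b *\<^sub>R coord_vec A c p v d"
    using linear_jac[of c d p] assms
    by (auto simp: coord_vec_apply linear_add linear_cmul)
qed

lemma linear_coord_vec:
  "c \<in> A \<Longrightarrow> p \<in> chart_dom c \<Longrightarrow> linear (\<lambda>e. coord_vec A c p e d)"
  using coord_vec_combine[of c p 1 _ 1] coord_vec_combine[of c p _ _ 0] by (auto intro!: linearI)

lemma tangent_combine:
  assumes "u \<in> tangent_space A p" "v \<in> tangent_space A p"
  shows "(\<lambda>c. a *\<^sub>R u c + b *\<^sub>R v c) \<in> tangent_space A p"
proof -
  have *: "a *\<^sub>R u d + b *\<^sub>R v d = jac c d p (a *\<^sub>R u c + b *\<^sub>R v c)"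
    if "c \<in> A" "d \<in> A" "p \<in> chart_dom c" "p \<in> chart_dom d" for c d
    using linear_jac[OF that] tangent_jac[OF assms(1) that(1,3,2,4)]
      tangent_jac[OF assms(2) that(1,3,2,4)]
    by (simp add: linear_add linear_cmul)
  have **: "u d = 0" "v d = 0" if "\<not> (d \<in> A \<and> p \<in> chart_dom d)" for d
    using assms that unfolding tangent_space_def by blast+
  show ?thesis
    unfolding tangent_space_def mem_Collect_eq
  proof (intro conjI ballI allI impI)
    show "a *\<^sub>R u d + b *\<^sub>R v d = 0" if "\<not> (d \<in> A \<and> p \<in> chart_dom d)" for d
      using **[OF that] by simp
  qed (use * in blast)
qed

lemma zero_tangent: "(\<lambda>_. 0) \<in> tangent_space A p"
  by (auto simp: tangent_space_def linear_0[OF linear_jac])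

lemma tangent_eq_zero_iff:
  "v \<in> tangent_space A p \<Longrightarrow> c \<in> A \<Longrightarrow> p \<in> chart_dom c \<Longrightarrow> v c = 0 \<longleftrightarrow> v = (\<lambda>_. 0)"
  by (metis tangent_eqI zero_tangent)

section \<open>The topology determined by the atlas\<close>

lemma openin_iff:
  "openin (atlas_topology M A) W \<longleftrightarrow>
    W \<subseteq> M \<and> (\<forall>c\<in>A. open (chart_map c ` (W \<inter> chart_dom c)))"
  by (rule openin_atlas_topology[OF smooth_atlas])

lemma topspace_atlas: "topspace (atlas_topology M A) = M"
proof
  have "openin (atlas_topology M A) M"
    unfolding openin_iff
  proof (intro conjI ballI)
    fix c assume c: "c \<in> A"
    then have "M \<inter> chart_dom c = chart_dom c"
      using M_eq by blast
    then show "open (chart_map c ` (M \<inter> chart_dom c))"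
      using open_chart_image[OF c] by simp
  qed simp
  then show "M \<subseteq> topspace (atlas_topology M A)"
    by (rule openin_subset)
  show "topspace (atlas_topology M A) \<subseteq> M"
    using openin_topspace openin_iff by blast
qed

text \<open>Seen in another chart \<open>d\<close>, the set is the preimage of \<open>U\<close>
  under the continuous transition from \<open>d\<close> to \<open>c\<close>.\<close>

lemma openin_chart_inv:
  assumes c: "c \<in> A" and U: "open U" "U \<subseteq> chart_map c ` chart_dom c"
  shows "openin (atlas_topology M A) (chart_inv c ` U)"
  unfolding openin_iff
proof (intro conjI ballI)
  show "chart_inv c ` U \<subseteq> M"
    using U c M_eq by fastforce
  fix d assume d: "d \<in> A"
  have "chart_map d ` (chart_inv c ` U \<inter> chart_dom d) = overlap d c \<inter> transition d c -` U"
  proof (intro equalityI subsetI)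
    fix x assume "x \<in> chart_map d ` (chart_inv c ` U \<inter> chart_dom d)"
    then obtain z where z: "z \<in> U" "chart_inv c z \<in> chart_dom d" "x = chart_map d (chart_inv c z)"
      by auto
    obtain q where "q \<in> chart_dom c" "z = chart_map c q" using z U by auto
    then show "x \<in> overlap d c \<inter> transition d c -` U"
      using z c d by auto
  next
    fix x assume "x \<in> overlap d c \<inter> transition d c -` U"
    then obtain q where q: "q \<in> chart_dom d" "q \<in> chart_dom c" "x = chart_map d q" "chart_map c q \<in> U"
      using d by auto
    then have "q \<in> chart_inv c ` U"
      using c by (metis chart_inv_map image_eqI)
    then show "x \<in> chart_map d ` (chart_inv c ` U \<inter> chart_dom d)"
      using q by auto
  qed
  moreover have "open (overlap d c \<inter> transition d c -` U)"
    using continuous_open_preimage[OF smooth_on_continuous_on[OF smooth_transition[OF d c]]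
        open_overlap[OF d c] U(1)] .
  ultimately show "open (chart_map d ` (chart_inv c ` U \<inter> chart_dom d))" by simp
qed

text \<open>A countable base of the Euclidean space is pulled back through the countably many charts
  of the cover.\<close>

lemma second_countable_if_countable_cover:
  assumes A0: "A0 \<subseteq> A" "countable A0" "M \<subseteq> (\<Union>c\<in>A0. chart_dom c)"
  shows "second_countable_space (atlas_topology M A)"
proof -
  obtain B :: "'e set set" where B: "countable B" "\<And>b. b \<in> B \<Longrightarrow> open b"
    "\<And>S. open S \<Longrightarrow> \<exists>B'\<subseteq>B. S = \<Union>B'"
    using univ_second_countable by metis
  define \<B> where "\<B> = (\<lambda>(c, b). chart_inv c ` b) ` {(c, b)\<in>A0 \<times> B. b \<subseteq> chart_map c ` chart_dom c}"
  show ?thesis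
    unfolding second_countable_space_def
  proof (intro exI[of _ \<B>] conjI ballI allI impI)
    have "countable {(c, b)\<in>A0 \<times> B. b \<subseteq> chart_map c ` chart_dom c}"
      by (rule countable_subset[of _ "A0 \<times> B"]) (use A0 B in auto)
    then show "countable \<B>"
      unfolding \<B>_def by (rule countable_image)
    show "openin (atlas_topology M A) V" if "V \<in> \<B>" for V
      using that A0 B by (auto simp: \<B>_def intro!: openin_chart_inv)
    fix W p assume "openin (atlas_topology M A) W \<and> p \<in> W"
    then have W: "openin (atlas_topology M A) W" "p \<in> W" by auto
    then obtain c where c: "c \<in> A0" "p \<in> chart_dom c"
      using A0 openin_iff by blast
    then have "open (chart_map c ` (W \<inter> chart_dom c))"
      using W A0 openin_iff by auto
    then obtain B' where B': "B' \<subseteq> B" "chart_map c ` (W \<inter> chart_dom c) = \<Union>B'"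
      using B(3) by metis
    then obtain b where b: "b \<in> B'" "chart_map c p \<in> b"
      using W c by (metis IntI UnionE imageI)
    have sub: "b \<subseteq> chart_map c ` (W \<inter> chart_dom c)"
      using b B' by auto
    have "chart_inv c ` b \<in> \<B>"
      unfolding \<B>_def using b B' c sub by (intro image_eqI[of _ _ "(c, b)"]) auto
    moreover have "p \<in> chart_inv c ` b"
      using b c A0 by (metis chart_inv_map image_eqI subsetD)
    moreover have "chart_inv c ` b \<subseteq> W"
    proof
      fix x assume "x \<in> chart_inv c ` b"
      then obtain q where "q \<in> W" "q \<in> chart_dom c" "x = chart_inv c (chart_map c q)"
        using sub by blast
      then show "x \<in> W" using c A0 by auto
    qed
    ultimately show "\<exists>V\<in>\<B>. p \<in> V \<and> V \<subseteq> W" by auto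
  qed
qed

text \<open>The Lindeloef argument: the basic sets contained in some chart domain already cover
  \<open>M\<close>, and one chart is chosen for each of them.\<close>

lemma countable_chart_cover:
  assumes "second_countable_space (atlas_topology M A)"
  obtains A0 where "A0 \<subseteq> A" "countable A0" "M \<subseteq> (\<Union>c\<in>A0. chart_dom c)"
proof -
  obtain \<B> where \<B>: "countable \<B>" "\<And>V. V \<in> \<B> \<Longrightarrow> openin (atlas_topology M A) V"
    "\<And>U x. openin (atlas_topology M A) U \<Longrightarrow> x \<in> U \<Longrightarrow> \<exists>V\<in>\<B>. x \<in> V \<and> V \<subseteq> U"
    using assms unfolding second_countable_space_def by metis
  define \<B>' where "\<B>' = {V\<in>\<B>. \<exists>c\<in>A. V \<subseteq> chart_dom c}"
  define ch where "ch V = (SOME c. c \<in> A \<and> V \<subseteq> chart_dom c)" for V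
  have ch: "ch V \<in> A \<and> V \<subseteq> chart_dom (ch V)" if "V \<in> \<B>'" for V
    unfolding ch_def by (rule someI_ex) (use that \<B>'_def in blast)
  show ?thesis
  proof (rule that[of "ch ` \<B>'"])
    show "ch ` \<B>' \<subseteq> A" using ch by auto
    show "countable (ch ` \<B>')"
      by (intro countable_image countable_subset[OF _ \<B>(1)]) (auto simp: \<B>'_def)
    show "M \<subseteq> (\<Union>c\<in>ch ` \<B>'. chart_dom c)"
    proof
      fix p assume "p \<in> M"
      then obtain c where c: "c \<in> A" "p \<in> chart_dom c"
        using chart_exists by blast
      have "openin (atlas_topology M A) (chart_inv c ` chart_map c ` chart_dom c)"
        by (rule openin_chart_inv) (use c open_chart_image in auto)
      moreover have "chart_inv c ` chart_map c ` chart_dom c = chart_dom c"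
        using c by (auto simp: image_iff)
      ultimately obtain V where V: "V \<in> \<B>" "p \<in> V" "V \<subseteq> chart_dom c"
        using \<B>(3) c by metis
      then have "V \<in> \<B>'" using c by (auto simp: \<B>'_def)
      then show "p \<in> (\<Union>c\<in>ch ` \<B>'. chart_dom c)"
        using ch V by blast
    qed
  qed
qed

end

section \<open>The slit tangent bundle as a manifold\<close>

lemma fst_mem_slit: "q \<in> slit_tangent_bundle M A \<Longrightarrow> fst q \<in> M"
  by (auto simp: slit_tangent_bundle_def)

lemma induced_dom: "chart_dom (induced_chart M A c) = {q \<in> slit_tangent_bundle M A. fst q \<in> chart_dom c}"
  by (simp add: induced_chart_def)

lemma induced_map: "chart_map (induced_chart M A c) q = (chart_map c (fst q), snd q c)"
  by (simp add: induced_chart_def case_prod_beta)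

context atlas
begin

abbreviation TM where "TM \<equiv> slit_tangent_bundle M A"
abbreviation TA where "TA \<equiv> slit_atlas M A"
abbreviation ind where "ind \<equiv> induced_chart M A"

lemma slit_point:
  assumes "c \<in> A" "p \<in> chart_dom c" "y \<noteq> 0"
  shows "(p, coord_vec A c p y) \<in> TM"
proof -
  have "p \<in> M"
    using assms M_eq by blast
  moreover have "coord_vec A c p y \<noteq> (\<lambda>_. 0)"
    using coord_vec_self[OF assms(1,2), of y] assms(3) by auto
  ultimately show ?thesis
    using coord_vec_tangent[OF assms(1,2)] by (simp add: slit_tangent_bundle_def)
qed

lemma slit_tangent: "q \<in> TM \<Longrightarrow> snd q \<in> tangent_space A (fst q)"
  by (auto simp: slit_tangent_bundle_def)

lemma slit_component_nonzero:
  assumes "q \<in> TM" "c \<in> A" "fst q \<in> chart_dom c"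
  shows "snd q c \<noteq> 0"
  using tangent_eq_zero_iff[OF slit_tangent[OF assms(1)] assms(2,3)] assms(1)
  by (simp add: slit_tangent_bundle_def case_prod_beta)

text \<open>Every nonzero \<open>y\<close> occurs as a fibre coordinate, namely that of
  \<open>coord_vec A c p y\<close>. With \<open>W\<close> an overlap this computes chart images in
  the bundle; with \<open>W\<close> cut out by an open set of the base it shows that the projection
  is continuous.\<close>

lemma induced_image_preimage:
  assumes c: "c \<in> A" and W: "W \<subseteq> chart_dom c"
  shows "chart_map (ind c) ` {q \<in> TM. fst q \<in> W} = (chart_map c ` W) \<times> (- {0 :: 'e})"
proof (intro equalityI subsetI)
  fix z :: "'e \<times> 'e" assume "z \<in> chart_map (ind c) ` {q \<in> TM. fst q \<in> W}"
  then obtain q where "q \<in> TM" "fst q \<in> W" "z = chart_map (ind c) q"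
    by blast
  then show "z \<in> (chart_map c ` W) \<times> (- {0})"
    using slit_component_nonzero[of q c] c W by (auto simp: induced_map)
next
  fix z :: "'e \<times> 'e" assume "z \<in> (chart_map c ` W) \<times> (- {0})"
  then obtain p y where z: "p \<in> W" "y \<noteq> 0" "z = (chart_map c p, y)" by auto
  then show "z \<in> chart_map (ind c) ` {q \<in> TM. fst q \<in> W}"
    using c W slit_point[of c p y]
    by (intro image_eqI[of _ _ "(p, coord_vec A c p y)"]) (auto simp: induced_map subset_iff)
qed

lemma induced_overlap:
  assumes "c \<in> A"
  shows "chart_map (ind c) ` (chart_dom (ind c) \<inter> chart_dom (ind d)) = overlap c d \<times> (- {0})"
proof -
  have "chart_dom (ind c) \<inter> chart_dom (ind d) = {q \<in> TM. fst q \<in> chart_dom c \<inter> chart_dom d}"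
    by (auto simp: induced_dom)
  then show ?thesis
    using induced_image_preimage[OF assms, of "chart_dom c \<inter> chart_dom d"] by simp
qed

lemma induced_image:
  assumes "c \<in> A"
  shows "chart_map (ind c) ` chart_dom (ind c) = (chart_map c ` chart_dom c) \<times> (- {0})"
  using induced_overlap[OF assms, of c] by simp

lemma inj_induced: "c \<in> A \<Longrightarrow> inj_on (chart_map (ind c)) (chart_dom (ind c))"
proof (rule inj_onI)
  fix q r assume c: "c \<in> A" and q: "q \<in> chart_dom (ind c)" and r: "r \<in> chart_dom (ind c)"
    and eq: "chart_map (ind c) q = chart_map (ind c) r"
  then have "fst q = fst r"
    using inj_chart[OF c] by (auto simp: induced_dom induced_map inj_on_def)
  moreover have "snd q = snd r"
    using tangent_eqI[of "snd q" "fst q" "snd r" c] c q r eq calculation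
      slit_tangent[of q] slit_tangent[of r]
    by (auto simp: induced_dom induced_map)
  ultimately show "q = r" by (simp add: prod_eq_iff)
qed

lemma induced_inv:
  assumes "c \<in> A" "p \<in> chart_dom c" "y \<noteq> 0"
  shows "chart_inv (ind c) (chart_map c p, y) = (p, coord_vec A c p y)"
proof -
  have "(p, coord_vec A c p y) \<in> chart_dom (ind c)"
    using slit_point[OF assms] assms by (simp add: induced_dom)
  moreover have "chart_map (ind c) (p, coord_vec A c p y) = (chart_map c p, y)"
    using assms by (simp add: induced_map)
  ultimately show ?thesis
    using inj_induced[OF assms(1)] by (metis chart_inv_def inv_into_f_f)
qed

lemma induced_transition:
  assumes c: "c \<in> A" and d: "d \<in> A" and z: "z \<in> overlap c d \<times> (- {0})"
  shows "transition (ind c) (ind d) z = (transition c d (fst z), fd (transition c d) (fst z) (snd z))"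
proof -
  obtain p y where "z = (chart_map c p, y)" "p \<in> chart_dom c" "p \<in> chart_dom d" "y \<noteq> 0"
    using z by auto
  then show ?thesis
    using c d by (simp add: transition_def[of "ind c"] induced_inv induced_map coord_vec_apply)
qed

lemma open_slit_overlap: "c \<in> A \<Longrightarrow> d \<in> A \<Longrightarrow> open (overlap c d \<times> (- {0::'e}))"
  by (intro open_Times open_overlap) auto

lemma smooth_induced_transition:
  assumes c: "c \<in> A" and d: "d \<in> A"
  shows "smooth_on (transition (ind c) (ind d)) (overlap c d \<times> (- {0}))"
proof (rule smooth_on_cong[OF open_slit_overlap[OF c d]])
  have fs: "smooth_on fst (overlap c d \<times> (- {0::'e}))" "smooth_on snd (overlap c d \<times> (- {0::'e}))"
    using smooth_on_bounded_linear[OF open_slit_overlap[OF c d] bounded_linear_fst smooth_on_ident]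
      smooth_on_bounded_linear[OF open_slit_overlap[OF c d] bounded_linear_snd smooth_on_ident]
      open_slit_overlap[OF c d] by auto
  show "smooth_on (\<lambda>z. (transition c d (fst z), fd (transition c d) (fst z) (snd z)))
      (overlap c d \<times> (- {0}))"
    by (intro smooth_on_Pair open_slit_overlap c d
        smooth_on_compose[OF _ open_overlap[OF c d] _ smooth_transition[OF c d]]
        smooth_on_fd_apply[OF _ open_overlap[OF c d] smooth_transition[OF c d]] fs) auto
qed (simp add: induced_transition c d)

lemma smooth_atlas_slit: "smooth_atlas TM TA"
  unfolding smooth_atlas_def
proof (intro conjI)
  show "TM = (\<Union>C\<in>TA. chart_dom C)"
  proof (intro equalityI subsetI)
    fix q assume q: "q \<in> TM"
    then obtain c where "c \<in> A" "fst q \<in> chart_dom c"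
      using chart_exists fst_mem_slit by blast
    then show "q \<in> (\<Union>C\<in>TA. chart_dom C)"
      using q unfolding slit_atlas_def by (intro UN_I[of "ind c"]) (auto simp: induced_dom)
  qed (auto simp: slit_atlas_def induced_dom)
  show "\<forall>C\<in>TA. inj_on (chart_map C) (chart_dom C)"
    by (auto simp: slit_atlas_def inj_induced)
  show "\<forall>C\<in>TA. \<forall>D\<in>TA. open (chart_map C ` (chart_dom C \<inter> chart_dom D)) \<and>
      smooth_on (transition C D) (chart_map C ` (chart_dom C \<inter> chart_dom D))"
    unfolding slit_atlas_def ball_simps
    by (auto simp: induced_overlap smooth_induced_transition intro!: open_Times open_overlap)
qed

lemma atlas_slit: "atlas TM TA"
  by unfold_locales (rule smooth_atlas_slit)

section \<open>Derivatives of the induced transition maps\<close>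

lemma second_derivative_transition:
  assumes "c \<in> A" "d \<in> A" "p \<in> chart_dom c" "p \<in> chart_dom d"
  shows "((\<lambda>x. fd (transition c d) x y) has_derivative
      fd (\<lambda>x. fd (transition c d) x y) (chart_map c p)) (at (chart_map c p))"
  by (rule smooth_on_has_derivative[OF smooth_on_fd[OF smooth_transition[OF assms(1,2)]]])
    (use assms in auto)

text \<open>The fibre component applies a derivative that depends on the base coordinate to the
  fibre coordinate. Expanding the latter in the basis turns this into a sum of products, whose
  derivative splits into a part from the fibre coordinate and a part from the base
  coordinate.\<close>

lemma induced_transition_derivative:
  assumes c: "c \<in> A" and d: "d \<in> A" and p: "p \<in> chart_dom c" "p \<in> chart_dom d" and y: "y \<noteq> 0"
  shows "fd (transition (ind c) (ind d)) (chart_map c p, y) (u, w) =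
    (jac c d p u, jac c d p w + fd (\<lambda>x. fd (transition c d) x y) (chart_map c p) u)"
proof -
  let ?\<tau> = "transition c d" and ?x = "chart_map c p"
  define F where "F z = (?\<tau> (fst z), \<Sum>b\<in>Basis. (snd z \<bullet> b) *\<^sub>R fd ?\<tau> (fst z) b)" for z :: "'e \<times> 'e"
  have lin: "linear (fd ?\<tau> x)" if "x \<in> overlap c d" for x
    using that smooth_on_linear_fd[OF smooth_transition[OF c d]] by auto
  have fst': "((\<lambda>z. f (fst z)) has_derivative (\<lambda>z. f' (fst z))) (at (?x, y))"
    if "(f has_derivative f') (at ?x)" for f :: "'e \<Rightarrow> 'e" and f'
  proof -
    have "(fst has_derivative fst) (at (?x, y))"
      by (rule has_derivative_fst[OF has_derivative_ident])
    then show ?thesis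
      using diff_chain_at[of fst fst "(?x, y)" f f'] that by (simp add: o_def)
  qed
  have "(F has_derivative (\<lambda>z. (jac c d p (fst z), \<Sum>b\<in>Basis. (y \<bullet> b) *\<^sub>R
      fd (\<lambda>x. fd ?\<tau> x b) ?x (fst z) + (snd z \<bullet> b) *\<^sub>R jac c d p b))) (at (?x, y))"
    unfolding F_def
  proof (intro has_derivative_Pair has_derivative_sum)
    show "((\<lambda>z. ?\<tau> (fst z)) has_derivative (\<lambda>z. jac c d p (fst z))) (at (?x, y))"
      by (rule fst'[OF transition_has_derivative[OF c d p]])
    fix b :: 'e
    have "((\<lambda>z. snd z \<bullet> b) has_derivative (\<lambda>z. snd z \<bullet> b)) (at (?x, y))"
      by (rule has_derivative_inner_left[OF has_derivative_snd[OF has_derivative_ident]])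
    from has_derivative_scaleR[OF this fst'[OF second_derivative_transition[OF c d p, of b]]]
    show "((\<lambda>z. (snd z \<bullet> b) *\<^sub>R fd ?\<tau> (fst z) b) has_derivative (\<lambda>z. (y \<bullet> b) *\<^sub>R
      fd (\<lambda>x. fd ?\<tau> x b) ?x (fst z) + (snd z \<bullet> b) *\<^sub>R jac c d p b)) (at (?x, y))"
      by simp
  qed
  then have "fd F (?x, y) (u, w) = (jac c d p u, \<Sum>b\<in>Basis. (y \<bullet> b) *\<^sub>R
      fd (\<lambda>x. fd ?\<tau> x b) ?x u + (w \<bullet> b) *\<^sub>R jac c d p b)"
    by (simp add: fd_eqI)
  moreover have "fd F (?x, y) = fd (transition (ind c) (ind d)) (?x, y)"
  proof (rule fd_cong_open[OF open_slit_overlap[OF c d]])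
    fix z :: "'e \<times> 'e" assume z: "z \<in> overlap c d \<times> (- {0})"
    show "transition (ind c) (ind d) z = F z"
      using z linear_euclidean_expansion[OF lin, of "fst z" "snd z"]
      by (auto simp: induced_transition[OF c d z] F_def)
  qed (use p y in auto)
  moreover have "(\<Sum>b\<in>Basis. (w \<bullet> b) *\<^sub>R jac c d p b) = jac c d p w"
    using linear_euclidean_expansion[OF linear_jac[OF c d p], of w] by simp
  \<comment> \<open>With \<open>y\<close> frozen, the basis expansion is undone under the outer
    derivative.\<close>
  moreover have "(\<Sum>b\<in>Basis. (y \<bullet> b) *\<^sub>R fd (\<lambda>x. fd ?\<tau> x b) ?x u) = fd (\<lambda>x. fd ?\<tau> x y) ?x u"
  proof -
    have "((\<lambda>x. \<Sum>b\<in>Basis. (y \<bullet> b) *\<^sub>R fd ?\<tau> x b) has_derivative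
        (\<lambda>u. \<Sum>b\<in>Basis. (y \<bullet> b) *\<^sub>R fd (\<lambda>x. fd ?\<tau> x b) ?x u)) (at ?x)"
      by (intro has_derivative_sum has_derivative_scaleR_right second_derivative_transition c d p)
    then have "fd (\<lambda>x. \<Sum>b\<in>Basis. (y \<bullet> b) *\<^sub>R fd ?\<tau> x b) ?x u =
        (\<Sum>b\<in>Basis. (y \<bullet> b) *\<^sub>R fd (\<lambda>x. fd ?\<tau> x b) ?x u)"
      by (simp add: fd_eqI)
    moreover have "fd (\<lambda>x. fd ?\<tau> x y) ?x = fd (\<lambda>x. \<Sum>b\<in>Basis. (y \<bullet> b) *\<^sub>R fd ?\<tau> x b) ?x"
      by (rule fd_cong_open[OF open_overlap[OF c d], symmetric])
        (use p linear_euclidean_expansion[OF lin, of _ y] in auto)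
    ultimately show ?thesis by simp
  qed
  ultimately show ?thesis
    by (simp add: sum.distrib)
qed

text \<open>Points over different base points are separated by preimages of open sets of the base.
  Points over the same base point lie in one induced chart and are separated there as in Euclidean
  space.\<close>

lemma Hausdorff_slit:
  assumes "Hausdorff_space (atlas_topology M A)"
  shows "Hausdorff_space (atlas_topology TM TA)"
proof -
  interpret T: atlas TM TA by (rule atlas_slit)
  show ?thesis
    unfolding Hausdorff_space_def T.topspace_atlas
  proof (intro allI impI)
    fix q r assume qr: "q \<in> TM \<and> r \<in> TM \<and> q \<noteq> r"
    then have q: "q \<in> TM" and r: "r \<in> TM" and ne: "q \<noteq> r" by auto
    show "\<exists>U V. openin (atlas_topology TM TA) U \<and> openin (atlas_topology TM TA) V \<and>
        q \<in> U \<and> r \<in> V \<and> disjnt U V"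
    proof (cases "fst q = fst r")
      case False
      then obtain U V where UV: "openin (atlas_topology M A) U" "openin (atlas_topology M A) V"
        "fst q \<in> U" "fst r \<in> V" "disjnt U V"
        using assms fst_mem_slit[OF q] fst_mem_slit[OF r]
        unfolding Hausdorff_space_def topspace_atlas by metis
      have op: "openin (atlas_topology TM TA) {q \<in> TM. fst q \<in> W}"
        if "openin (atlas_topology M A) W" for W
        unfolding T.openin_iff
      proof (intro conjI ballI)
        fix C assume "C \<in> TA"
        then obtain c where c: "c \<in> A" "C = ind c" by (auto simp: slit_atlas_def)
        have "{q \<in> TM. fst q \<in> W} \<inter> chart_dom C = {q \<in> TM. fst q \<in> W \<inter> chart_dom c}"
          by (auto simp: c induced_dom)
        then have "chart_map C ` ({q \<in> TM. fst q \<in> W} \<inter> chart_dom C) =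
            (chart_map c ` (W \<inter> chart_dom c)) \<times> (- {0})"
          using induced_image_preimage[OF c(1), of "W \<inter> chart_dom c"] by (simp add: c)
        moreover have "open (chart_map c ` (W \<inter> chart_dom c))"
          using that c openin_iff by auto
        ultimately show "open (chart_map C ` ({q \<in> TM. fst q \<in> W} \<inter> chart_dom C))"
          by (simp add: open_Times open_Compl)
      qed auto
      show ?thesis
        by (rule exI[of _ "{q \<in> TM. fst q \<in> U}"], rule exI[of _ "{q \<in> TM. fst q \<in> V}"])
          (use UV op q r in \<open>auto simp: disjnt_def\<close>)
    next
      case True
      obtain c where c: "c \<in> A" "fst q \<in> chart_dom c"
        using chart_exists fst_mem_slit[OF q] by blast
      then have dom: "q \<in> chart_dom (ind c)" "r \<in> chart_dom (ind c)" "ind c \<in> TA"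
        using True q r by (auto simp: induced_dom slit_atlas_def)
      then have "chart_map (ind c) q \<noteq> chart_map (ind c) r"
        using ne inj_induced[OF c(1)] by (auto simp: inj_on_def)
      then obtain U V where UV: "open U" "open V" "chart_map (ind c) q \<in> U" "chart_map (ind c) r \<in> V"
        "U \<inter> V = {}"
        using hausdorff by metis
      let ?I = "chart_map (ind c) ` chart_dom (ind c)"
      have op: "openin (atlas_topology TM TA) (chart_inv (ind c) ` (W \<inter> ?I))" if "open W" for W
        using that T.open_chart_image[OF dom(3)] by (intro T.openin_chart_inv dom(3)) auto
      have mem: "s \<in> chart_inv (ind c) ` (W \<inter> ?I)"
        if "s \<in> chart_dom (ind c)" "chart_map (ind c) s \<in> W" for s W
        using that T.chart_inv_map[OF dom(3) that(1)] by (metis IntI image_eqI)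
      have "disjnt (chart_inv (ind c) ` (U \<inter> ?I)) (chart_inv (ind c) ` (V \<inter> ?I))"
      proof -
        have "U \<inter> ?I \<inter> (V \<inter> ?I) = {}"
          using UV(5) by blast
        moreover have "inj_on (chart_inv (ind c)) ?I"
          unfolding chart_inv_def by (rule inj_on_inv_into) simp
        ultimately show ?thesis
          unfolding disjnt_def by (subst inj_on_image_Int[symmetric, of _ ?I]) auto
      qed
      then show ?thesis
        using op[OF UV(1)] op[OF UV(2)] mem[OF dom(1) UV(3)] mem[OF dom(2) UV(4)] by meson
    qed
  qed
qed

lemma smooth_manifold_slit:
  assumes "smooth_manifold M A"
  shows "smooth_manifold TM TA"
proof -
  interpret T: atlas TM TA by (rule atlas_slit)
  obtain A0 where A0: "A0 \<subseteq> A" "countable A0" "M \<subseteq> (\<Union>c\<in>A0. chart_dom c)"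
    using assms countable_chart_cover unfolding smooth_manifold_def by metis
  have "TM \<subseteq> (\<Union>C\<in>ind ` A0. chart_dom C)"
    using A0(3) fst_mem_slit by (fastforce simp: induced_dom)
  then have "second_countable_space (atlas_topology TM TA)"
    using A0 by (intro T.second_countable_if_countable_cover[of "ind ` A0"])
      (auto simp: slit_atlas_def)
  then show ?thesis
    using assms Hausdorff_slit smooth_atlas_slit by (auto simp: smooth_manifold_def)
qed

end

section \<open>The metric and its Christoffel symbols in a chart\<close>

lemma linear_vec_expansion:
  fixes L :: "real^'n \<Rightarrow> 'b::real_vector"
  assumes "linear L"
  shows "L v = (\<Sum>i\<in>UNIV. v $ i *\<^sub>R L (axis i 1))"
proof -
  have "v = (\<Sum>i\<in>UNIV. v $ i *\<^sub>R axis i 1)"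
    using basis_expansion[of v] by (simp add: scalar_mult_eq_scaleR)
  then have "L v = L (\<Sum>i\<in>UNIV. v $ i *\<^sub>R axis i 1)"
    by simp
  also have "\<dots> = (\<Sum>i\<in>UNIV. v $ i *\<^sub>R L (axis i 1))"
    by (simp add: linear_sum[OF assms] linear_cmul[OF assms])
  finally show ?thesis .
qed

lemma linear_axis_eqI:
  fixes L L' :: "real^'n \<Rightarrow> 'b::real_vector"
  assumes "linear L" "linear L'" "\<And>i. L (axis i 1) = L' (axis i 1)"
  shows "L v = L' v"
  using linear_vec_expansion[OF assms(1), of v] linear_vec_expansion[OF assms(2), of v] assms(3)
  by simp

locale riemannian = atlas M A for M :: "'p set" and A :: "('p, real^'n) chart set" +
  fixes g :: "'p \<Rightarrow> ('p, real^'n) tvec \<Rightarrow> ('p, real^'n) tvec \<Rightarrow> real"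
  assumes tensor_g: "tensor_02 M A g"
    and sym_g: "\<And>p u v. p \<in> M \<Longrightarrow> u \<in> tangent_space A p \<Longrightarrow> v \<in> tangent_space A p \<Longrightarrow> g p u v = g p v u"
    and pos_g: "\<And>p u. p \<in> M \<Longrightarrow> u \<in> tangent_space A p \<Longrightarrow> u \<noteq> (\<lambda>_. 0) \<Longrightarrow> g p u u > 0"
begin

abbreviation gc :: "('p, real^'n) chart \<Rightarrow> 'n \<Rightarrow> 'n \<Rightarrow> 'p \<Rightarrow> real" where
  "gc \<equiv> metric_comp A g"

definition G :: "('p, real^'n) chart \<Rightarrow> 'p \<Rightarrow> real^'n \<Rightarrow> real^'n \<Rightarrow> real" where
  "G c p u v = (\<Sum>i\<in>UNIV. \<Sum>j\<in>UNIV. gc c i j p * u $ i * v $ j)"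

definition dG :: "('p, real^'n) chart \<Rightarrow> 'p \<Rightarrow> real^'n \<Rightarrow> real^'n \<Rightarrow> real^'n \<Rightarrow> real" where
  "dG c p w u v =
    (\<Sum>i\<in>UNIV. \<Sum>j\<in>UNIV. fd (gc c i j \<circ> chart_inv c) (chart_map c p) w * u $ i * v $ j)"

text \<open>The index order is that of \<open>delta_y\<close>, so that \<open>delta_y\<close>
  becomes the fibre component plus \<open>Gam\<close> of the fibre coordinate and the base
  component. The index-free form allows Jacobians to be inserted as arguments.\<close>

definition Gam :: "('p, real^'n) chart \<Rightarrow> 'p \<Rightarrow> real^'n \<Rightarrow> real^'n \<Rightarrow> real^'n" where
  "Gam c p u v = (\<chi> k. \<Sum>a\<in>UNIV. \<Sum>j\<in>UNIV. u $ a * christoffel A g c a j k p * v $ j)"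

lemma mem_M: "c \<in> A \<Longrightarrow> p \<in> chart_dom c \<Longrightarrow> p \<in> M"
  using M_eq by blast

lemma g_combine:
  assumes "p \<in> M" "u \<in> tangent_space A p" "v \<in> tangent_space A p" "w \<in> tangent_space A p"
  shows "g p (\<lambda>c. a *\<^sub>R u c + b *\<^sub>R v c) w = a * g p u w + b * g p v w"
    "g p w (\<lambda>c. a *\<^sub>R u c + b *\<^sub>R v c) = a * g p w u + b * g p w v"
  using tensor_g assms unfolding tensor_02_def by blast+

lemma linear_g_coord_vec:
  assumes c: "c \<in> A" "p \<in> chart_dom c" and w: "w \<in> tangent_space A p"
  shows "linear (\<lambda>u. g p (coord_vec A c p u) w)" "linear (\<lambda>u. g p w (coord_vec A c p u))"
proof -
  note T = coord_vec_tangent[OF c] and C = coord_vec_combine[OF c]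
  have 1: "g p (coord_vec A c p (a *\<^sub>R u + b *\<^sub>R v)) w =
        a * g p (coord_vec A c p u) w + b * g p (coord_vec A c p v) w"
    "g p w (coord_vec A c p (a *\<^sub>R u + b *\<^sub>R v)) =
        a * g p w (coord_vec A c p u) + b * g p w (coord_vec A c p v)" for a b u v
    unfolding C by (intro g_combine mem_M[OF c] T w)+
  show "linear (\<lambda>u. g p (coord_vec A c p u) w)" "linear (\<lambda>u. g p w (coord_vec A c p u))"
    using 1[of 1 _ 1] 1[of _ _ 0] by (auto intro!: linearI)
qed

text \<open>The bridge from coordinates to the tensor: symmetry, positivity and invariance of
  \<open>G\<close> are all read off from \<open>g\<close> through it.\<close>

lemma G_eq_g:
  assumes c: "c \<in> A" "p \<in> chart_dom c"
  shows "G c p u v = g p (coord_vec A c p u) (coord_vec A c p v)"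
proof -
  note T = coord_vec_tangent[OF c]
  have "g p (coord_vec A c p u) (coord_vec A c p v) =
      (\<Sum>i\<in>UNIV. u $ i * g p (coord_vec A c p (axis i 1)) (coord_vec A c p v))"
    using linear_vec_expansion[OF linear_g_coord_vec(1)[OF c T], of u] by simp
  also have "\<dots> = (\<Sum>i\<in>UNIV. u $ i * (\<Sum>j\<in>UNIV. v $ j * gc c i j p))"
    using linear_vec_expansion[OF linear_g_coord_vec(2)[OF c T], of _ v]
    by (simp add: metric_comp_def)
  finally show ?thesis
    by (simp add: G_def sum_distrib_left mult_ac)
qed

lemma smooth_gc:
  assumes "c \<in> A"
  shows "smooth_on (gc c i j \<circ> chart_inv c) (chart_map c ` chart_dom c)"
proof -
  have "\<forall>e\<in>Basis. \<forall>f\<in>Basis. smooth_on (\<lambda>x. g (chart_inv c x) (coord_vec A c (chart_inv c x) e)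
      (coord_vec A c (chart_inv c x) f)) (chart_map c ` chart_dom c)"
    using tensor_g assms unfolding tensor_02_def by blast
  then have "smooth_on (\<lambda>x. g (chart_inv c x) (coord_vec A c (chart_inv c x) (axis i 1))
      (coord_vec A c (chart_inv c x) (axis j 1))) (chart_map c ` chart_dom c)"
    by (simp add: axis_in_Basis_iff)
  then show ?thesis
    by (simp add: metric_comp_def[abs_def] o_def)
qed

lemma gc_has_derivative:
  assumes "c \<in> A" "p \<in> chart_dom c"
  shows "((gc c i j \<circ> chart_inv c) has_derivative fd (gc c i j \<circ> chart_inv c) (chart_map c p))
    (at (chart_map c p))"
  by (rule smooth_on_has_derivative[OF smooth_gc[OF assms(1)]]) (use assms in auto)

lemma linear_G:
  "linear (\<lambda>u. G c p u v)" "linear (\<lambda>v. G c p u v)"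
  by (auto intro!: linearI simp: G_def algebra_simps sum.distrib sum_distrib_left)

lemma linear_dG:
  assumes "c \<in> A" "p \<in> chart_dom c"
  shows "linear (\<lambda>w. dG c p w u v)" "linear (\<lambda>u. dG c p w u v)" "linear (\<lambda>v. dG c p w u v)"
proof -
  note lin = has_derivative_linear[OF gc_has_derivative[OF assms]]
  show "linear (\<lambda>w. dG c p w u v)" "linear (\<lambda>u. dG c p w u v)" "linear (\<lambda>v. dG c p w u v)"
    by (auto intro!: linearI
        simp: dG_def linear_add[OF lin] linear_cmul[OF lin] algebra_simps sum.distrib sum_distrib_left)
qed

lemma linear_Gam:
  "linear (\<lambda>u. Gam c p u v)" "linear (\<lambda>v. Gam c p u v)"
  by (auto intro!: linearI simp: vec_eq_iff Gam_def algebra_simps sum.distrib sum_distrib_left)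

lemma G_sym: "c \<in> A \<Longrightarrow> p \<in> chart_dom c \<Longrightarrow> G c p u v = G c p v u"
  by (simp add: G_eq_g sym_g[OF mem_M] coord_vec_tangent)

lemma gc_sym: "c \<in> A \<Longrightarrow> p \<in> chart_dom c \<Longrightarrow> gc c i j p = gc c j i p"
  by (simp add: metric_comp_def sym_g[OF mem_M] coord_vec_tangent)

lemma G_pos:
  assumes "c \<in> A" "p \<in> chart_dom c" "u \<noteq> 0"
  shows "G c p u u > 0"
proof -
  have "coord_vec A c p u \<noteq> (\<lambda>_. 0)"
    using coord_vec_self[OF assms(1,2), of u] assms(3) by auto
  then show ?thesis
    using assms by (simp add: G_eq_g pos_g[OF mem_M] coord_vec_tangent)
qed

lemma G_nonneg: "c \<in> A \<Longrightarrow> p \<in> chart_dom c \<Longrightarrow> G c p u u \<ge> 0"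
  using G_pos[of c p u] linear_0[OF linear_G(1)] by (cases "u = 0") (auto intro: less_imp_le)

text \<open>The components \<open>u\<close> in \<open>c\<close> and \<open>jac c d p u\<close> in
  \<open>d\<close> belong to one tangent vector, so both sides are the same value of
  \<open>g\<close>.\<close>

lemma G_jac:
  assumes "c \<in> A" "d \<in> A" "p \<in> chart_dom c" "p \<in> chart_dom d"
  shows "G d p (jac c d p u) (jac c d p v) = G c p u v"
proof -
  have "coord_vec A d p (jac c d p u) = coord_vec A c p u" for u
    using assms by (intro tangent_eqI[of _ p _ d] coord_vec_tangent) (auto simp: coord_vec_apply)
  then show ?thesis
    using assms by (simp add: G_eq_g)
qed

section \<open>Christoffel symbols and the Koszul formula\<close>

lemma det_gc_nonzero:
  assumes "c \<in> A" "p \<in> chart_dom c"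
  shows "det (\<chi> i j. gc c i j p) \<noteq> 0"
proof -
  have "x = 0" if "(\<chi> i j. gc c i j p) *v x = 0" for x
  proof (rule ccontr)
    assume "x \<noteq> 0"
    \<comment> \<open>A nonzero kernel vector would be null for the positive definite form.\<close>
    have "G c p x x = (\<Sum>i\<in>UNIV. x $ i * ((\<chi> i j. gc c i j p) *v x) $ i)"
      by (simp add: G_def matrix_vector_mult_def sum_distrib_left mult_ac)
    then show False
      using G_pos[OF assms \<open>x \<noteq> 0\<close>] that by simp
  qed
  then have "\<exists>B. B ** (\<chi> i j. gc c i j p) = mat 1"
    using matrix_left_invertible_ker by blast
  then show ?thesis
    by (simp add: invertible_det_nz[symmetric] invertible_left_inverse)
qed

text \<open>Lowering the upper index multiplies the inverse metric in \<open>christoffel\<close> by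
  the metric; symmetry of \<open>gc\<close> brings the two matrices into the order of a
  product.\<close>

lemma christoffel_first_kind:
  assumes c: "c \<in> A" "p \<in> chart_dom c"
  shows "2 * (\<Sum>k\<in>UNIV. gc c k m p * christoffel A g c a j k p) =
    coord_deriv c a (gc c j m) p + coord_deriv c j (gc c a m) p - coord_deriv c m (gc c a j) p"
proof -
  define t where "t l = coord_deriv c a (gc c j l) p + coord_deriv c j (gc c a l) p
    - coord_deriv c l (gc c a j) p" for l
  define B where "B = (\<chi> i j. gc c i j p)"
  have "2 * (\<Sum>k\<in>UNIV. gc c k m p * christoffel A g c a j k p) =
      (\<Sum>k\<in>UNIV. \<Sum>l\<in>UNIV. B $ m $ k * matrix_inv B $ k $ l * t l)"
    by (simp add: christoffel_def t_def[symmetric] metric_inv_comp_def B_def[symmetric]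
        sum_distrib_left gc_sym[OF c, of _ m] mult_ac) (simp add: B_def mult_ac)
  also have "\<dots> = (\<Sum>l\<in>UNIV. (B ** matrix_inv B) $ m $ l * t l)"
    by (subst sum.swap) (simp add: matrix_matrix_mult_def sum_distrib_right)
  also have "\<dots> = (\<Sum>l\<in>UNIV. if l = m then t l else 0)"
    using det_gc_nonzero[OF c]
    by (intro sum.cong refl) (auto simp: matrix_inv_right_inverse B_def mat_def)
  also have "\<dots> = t m" by simp
  finally show ?thesis by (simp add: t_def)
qed

lemma sum_axis [simp]:
  fixes f :: "'n \<Rightarrow> real"
  shows "(\<Sum>i\<in>UNIV. f i * axis k 1 $ i) = f k" "(\<Sum>i\<in>UNIV. axis k 1 $ i * f i) = f k"
proof -
  have "f i * axis k 1 $ i = (if i = k then f i else 0)" "axis k 1 $ i * f i = (if i = k then f i else 0)" for i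
    by (simp_all add: axis_def)
  then show "(\<Sum>i\<in>UNIV. f i * axis k 1 $ i) = f k" "(\<Sum>i\<in>UNIV. axis k 1 $ i * f i) = f k"
    by simp_all
qed

text \<open>Vectors with constant components in a chart have vanishing brackets, so only the
  derivatives of the metric remain. Both sides are linear in each argument, and on coordinate
  vectors they agree by \<open>christoffel_first_kind\<close>.\<close>

lemma koszul:
  assumes c: "c \<in> A" "p \<in> chart_dom c"
  shows "2 * G c p (Gam c p u v) w = dG c p u v w + dG c p v u w - dG c p w u v"
proof -
  have scale: "linear (\<lambda>x. 2 * f x)" if "linear f" for f :: "real^'n \<Rightarrow> real"
    using that by (simp add: linear_iff algebra_simps)
  have GG: "linear (\<lambda>u. G c p (Gam c p u v) w)" "linear (\<lambda>v. G c p (Gam c p u v) w)"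
    "linear (\<lambda>w. G c p (Gam c p u v) w)" for u v w
    using linear_compose[OF linear_Gam(1) linear_G(1)] linear_compose[OF linear_Gam(2) linear_G(1)]
      linear_G(2) by (auto simp: o_def)
  have axes: "2 * G c p (Gam c p (axis a 1) (axis j 1)) (axis m 1) =
      dG c p (axis a 1) (axis j 1) (axis m 1) + dG c p (axis j 1) (axis a 1) (axis m 1)
      - dG c p (axis m 1) (axis a 1) (axis j 1)" for a j m
  proof -
    have "Gam c p (axis a 1) (axis j 1) $ k = christoffel A g c a j k p" for k
      by (simp add: Gam_def sum_distrib_left[symmetric] mult.assoc)
    then have "2 * G c p (Gam c p (axis a 1) (axis j 1)) (axis m 1) =
        2 * (\<Sum>k\<in>UNIV. gc c k m p * christoffel A g c a j k p)"
      by (simp add: G_def)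
    moreover have "dG c p (axis a 1) (axis j 1) (axis m 1) = coord_deriv c a (gc c j m) p" for a j m
      by (simp add: dG_def coord_deriv_def)
    ultimately show ?thesis
      using christoffel_first_kind[OF c] by simp
  qed
  have lin: "linear (\<lambda>w. 2 * G c p (Gam c p u v) w)" "linear (\<lambda>v. 2 * G c p (Gam c p u v) w)"
    "linear (\<lambda>u. 2 * G c p (Gam c p u v) w)"
    "linear (\<lambda>w. dG c p u v w + dG c p v u w - dG c p w u v)"
    "linear (\<lambda>v. dG c p u v w + dG c p v u w - dG c p w u v)"
    "linear (\<lambda>u. dG c p u v w + dG c p v u w - dG c p w u v)" for u v w
    by (intro scale GG linear_compose_add linear_compose_sub linear_dG c)+
  \<comment> \<open>From here the coordinate vectors are replaced by general ones in one argument at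
    a time: \<open>w\<close>, then \<open>v\<close>, then \<open>u\<close>.\<close>
  have "2 * G c p (Gam c p (axis a 1) (axis j 1)) w =
      dG c p (axis a 1) (axis j 1) w + dG c p (axis j 1) (axis a 1) w
      - dG c p w (axis a 1) (axis j 1)" for a j
    by (rule linear_axis_eqI[OF lin(1) lin(4), OF axes])
  then have "2 * G c p (Gam c p (axis a 1) v) w =
      dG c p (axis a 1) v w + dG c p v (axis a 1) w - dG c p w (axis a 1) v" for a
    by (rule linear_axis_eqI[OF lin(2) lin(5)])
  then show ?thesis
    by (rule linear_axis_eqI[OF lin(3) lin(6)])
qed

section \<open>Transformation law of the Christoffel symbols\<close>

abbreviation D2 :: "('p, real^'n) chart \<Rightarrow> ('p, real^'n) chart \<Rightarrow> 'p \<Rightarrow> real^'n \<Rightarrow> real^'n \<Rightarrow> real^'n" where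
  "D2 c d p u v \<equiv> fd (\<lambda>x. fd (transition c d) x v) (chart_map c p) u"

lemma D2_sym:
  assumes "c \<in> A" "d \<in> A" "p \<in> chart_dom c" "p \<in> chart_dom d"
  shows "D2 c d p u v = D2 c d p v u"
  by (rule second_derivative_symmetric[OF open_overlap smooth_transition]) (use assms in auto)

text \<open>The product rule for \<open>G_jac\<close> along the base: the three terms come from the
  metric coefficients of \<open>d\<close> and from the two Jacobians, all of which vary with the
  point.\<close>

lemma dG_jac:
  assumes cd: "c \<in> A" "d \<in> A" "p \<in> chart_dom c" "p \<in> chart_dom d"
  shows "dG c p w u v = dG d p (jac c d p w) (jac c d p u) (jac c d p v) +
    G d p (D2 c d p w u) (jac c d p v) + G d p (jac c d p u) (D2 c d p w v)"
proof -
  let ?\<tau> = "transition c d" and ?x = "chart_map c p" and ?J = "jac c d p"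
  let ?gd = "\<lambda>i j. gc d i j \<circ> chart_inv d"
  \<comment> \<open>\<open>F\<close> and \<open>E\<close> are the two sides of \<open>G_jac\<close>
    as functions of the coordinate; they agree on the overlap, which is enough to identify their
    derivatives.\<close>
  define F where "F x = (\<Sum>i\<in>UNIV. \<Sum>j\<in>UNIV. (gc c i j \<circ> chart_inv c) x * u $ i * v $ j)" for x
  define E where "E x = (\<Sum>i\<in>UNIV. \<Sum>j\<in>UNIV. (?gd i j (?\<tau> x) * fd ?\<tau> x u $ i) * fd ?\<tau> x v $ j)" for x
  have F: "(F has_derivative (\<lambda>w. dG c p w u v)) (at ?x)"
    unfolding F_def dG_def
    by (intro has_derivative_sum has_derivative_mult_left gc_has_derivative cd)
  have gd: "((\<lambda>x. ?gd i j (?\<tau> x)) has_derivative (\<lambda>w. fd (?gd i j) (chart_map d p) (?J w))) (at ?x)"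
    for i j
    using diff_chain_at[OF transition_has_derivative[OF cd], of "?gd i j"]
      gc_has_derivative[OF cd(2,4), of i j] cd by (simp add: o_def)
  have D: "((\<lambda>x. fd ?\<tau> x u $ i) has_derivative (\<lambda>w. D2 c d p w u $ i)) (at ?x)" for u i
    by (rule bounded_linear.has_derivative[OF bounded_linear_vec_nth second_derivative_transition[OF cd]])
  have "(E has_derivative (\<lambda>w. \<Sum>i\<in>UNIV. \<Sum>j\<in>UNIV.
      (?gd i j (?\<tau> ?x) * fd ?\<tau> ?x u $ i) * D2 c d p w v $ j +
      (?gd i j (?\<tau> ?x) * D2 c d p w u $ i + fd (?gd i j) (chart_map d p) (?J w) * fd ?\<tau> ?x u $ i)
        * fd ?\<tau> ?x v $ j)) (at ?x)"
    unfolding E_def by (intro has_derivative_sum has_derivative_mult gd D)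
  moreover have "fd F ?x = fd E ?x"
  proof (rule fd_cong_open[OF open_overlap[OF cd(1,2)]])
    fix x assume "x \<in> overlap c d"
    then obtain q where q: "q \<in> chart_dom c" "q \<in> chart_dom d" "x = chart_map c q" by blast
    then show "E x = F x"
      using G_jac[OF cd(1,2) q(1,2), of u v] cd by (simp add: E_def F_def G_def)
  qed (use cd in auto)
  ultimately have "dG c p w u v = (\<Sum>i\<in>UNIV. \<Sum>j\<in>UNIV.
      (?gd i j (?\<tau> ?x) * ?J u $ i) * D2 c d p w v $ j +
      (?gd i j (?\<tau> ?x) * D2 c d p w u $ i + fd (?gd i j) (chart_map d p) (?J w) * ?J u $ i)
        * ?J v $ j)"
    using F by (metis (no_types, lifting) fd_eqI)
  then show ?thesis
    using cd by (simp add: G_def dG_def algebra_simps sum.distrib)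
qed

lemma G_nondegenerate:
  assumes "c \<in> A" "p \<in> chart_dom c" "\<And>w. G c p x w = G c p y w"
  shows "x = y"
proof -
  have "G c p (x - y) (x - y) = 0"
    using assms(3) by (simp add: linear_diff[OF linear_G(1)])
  then show ?thesis
    using G_pos[OF assms(1,2), of "x - y"] by fastforce
qed

lemma Gam_jac:
  assumes cd: "c \<in> A" "d \<in> A" "p \<in> chart_dom c" "p \<in> chart_dom d"
  shows "jac c d p (Gam c p u v) = D2 c d p u v + Gam d p (jac c d p u) (jac c d p v)"
proof (rule G_nondegenerate[OF cd(2,4)])
  fix w'
  \<comment> \<open>The test vector is pulled back to \<open>c\<close>, so that invariance of
    \<open>G\<close> and both Koszul formulas apply to it.\<close>
  define w where "w = jac d c p w'"
  let ?J = "jac c d p"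
  have w': "?J w = w'"
    using cd by (simp add: w_def jac_cocycle)
  have "2 * G d p (?J (Gam c p u v)) (?J w) = 2 * G c p (Gam c p u v) w"
    by (simp add: G_jac cd)
  also have "\<dots> = dG c p u v w + dG c p v u w - dG c p w u v"
    by (rule koszul[OF cd(1,3)])
  \<comment> \<open>By symmetry of \<open>D2\<close>, the terms with \<open>D2\<close> of
    \<open>u, w\<close> and of \<open>v, w\<close> cancel in pairs, and the two terms with
    \<open>D2\<close> of \<open>u, v\<close> add up.\<close>
  also have "\<dots> = dG d p (?J u) (?J v) (?J w) + dG d p (?J v) (?J u) (?J w) - dG d p (?J w) (?J u) (?J v)
      + 2 * G d p (D2 c d p u v) (?J w)"
    unfolding dG_jac[OF cd]
    using D2_sym[OF cd, of u v] D2_sym[OF cd, of u w] D2_sym[OF cd, of v w]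
      G_sym[OF cd(2,4), of "D2 c d p w u" "?J v"]
    by simp
  also have "\<dots> = 2 * G d p (D2 c d p u v + Gam d p (?J u) (?J v)) (?J w)"
    by (simp add: koszul[OF cd(2,4), symmetric] linear_add[OF linear_G(1)])
  finally show "G d p (?J (Gam c p u v)) w' = G d p (D2 c d p u v + Gam d p (?J u) (?J v)) w'"
    by (simp add: w')
qed

lemma smooth_christoffel:
  assumes c: "c \<in> A"
  shows "smooth_on (\<lambda>x. christoffel A g c i j k (chart_inv c x)) (chart_map c ` chart_dom c)"
proof -
  let ?S = "chart_map c ` chart_dom c"
  note S = open_chart_image[OF c]
  have inv: "smooth_on (\<lambda>x. metric_inv_comp A g c k l (chart_inv c x)) ?S" for l
    unfolding metric_inv_comp_def
    by (rule smooth_on_matrix_inv[OF S])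
      (use smooth_gc[OF c] det_gc_nonzero[OF c] c in \<open>auto simp: o_def\<close>)
  have der: "smooth_on (\<lambda>x. coord_deriv c a (gc c b l) (chart_inv c x)) ?S" for a b l
    by (rule smooth_on_cong[OF S _ smooth_on_fd[OF smooth_gc[OF c], of b l "axis a 1"]])
      (use c in \<open>auto simp: coord_deriv_def\<close>)
  show ?thesis
    unfolding christoffel_def
    by (intro smooth_on_mult smooth_on_const smooth_on_sum smooth_on_add smooth_on_diff S inv der)
qed

end

section \<open>Horizontal and vertical parts\<close>

context riemannian
begin

interpretation T: atlas TM TA
  by (rule atlas_slit)

definition hpart :: "('p, real^'n) chart \<Rightarrow> ('p, real^'n) ttvec \<Rightarrow> real^'n" where
  "hpart c \<xi> = fst (\<xi> (ind c))"

definition vpart :: "('p, real^'n) chart \<Rightarrow> ('p, real^'n) tpoint \<Rightarrow> ('p, real^'n) ttvec \<Rightarrow> real^'n" where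
  "vpart c q \<xi> = snd (\<xi> (ind c)) + Gam c (fst q) (snd q c) (hpart c \<xi>)"

abbreviation N :: "('p, real^'n) chart \<Rightarrow> ('p, real^'n) tpoint \<Rightarrow> real" where
  "N \<equiv> fibre_norm A g"

lemma slit_chart_exists:
  assumes "q \<in> TM"
  obtains c where "c \<in> A" "fst q \<in> chart_dom c"
  using chart_exists[OF fst_mem_slit[OF assms]] by blast

lemma ind_TA: "c \<in> A \<Longrightarrow> ind c \<in> TA"
  by (simp add: slit_atlas_def)

lemma mem_ind_dom: "q \<in> TM \<Longrightarrow> fst q \<in> chart_dom c \<Longrightarrow> q \<in> chart_dom (ind c)"
  by (simp add: induced_dom)

lemma dx_eq: "dx M A c i \<xi> = hpart c \<xi> $ i"
  by (simp add: dx_def hpart_def)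

lemma delta_y_eq: "delta_y M A g c i q \<xi> = vpart c q \<xi> $ i"
  by (simp add: delta_y_def vpart_def Gam_def dx_eq)

lemma fibre_norm_eq: "N c q = sqrt (G c (fst q) (snd q c) (snd q c))"
  by (simp add: fibre_norm_def G_def)

lemma h_J_local_eq:
  "h_J_local M A g c q \<xi> \<eta> = - 2 * G c (fst q) (hpart c \<xi>) (hpart c \<eta>)
    + 2 / (N c q)\<^sup>2 * G c (fst q) (vpart c q \<xi>) (vpart c q \<eta>)"
  by (simp add: h_J_local_def dx_eq delta_y_eq G_def sum_distrib_left sum_negf mult_ac)

lemma hpart_combine: "hpart c (\<lambda>C. a *\<^sub>R \<xi> C + b *\<^sub>R \<eta> C) = a *\<^sub>R hpart c \<xi> + b *\<^sub>R hpart c \<eta>"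
  by (simp add: hpart_def)

lemma vpart_combine:
  "vpart c q (\<lambda>C. a *\<^sub>R \<xi> C + b *\<^sub>R \<eta> C) = a *\<^sub>R vpart c q \<xi> + b *\<^sub>R vpart c q \<eta>"
  by (simp add: vpart_def hpart_combine linear_add[OF linear_Gam(2)] linear_cmul[OF linear_Gam(2)]
      algebra_simps)

lemma parts_coord_vec:
  assumes "q \<in> TM" "c \<in> A" "fst q \<in> chart_dom c"
  shows "hpart c (coord_vec TA (ind c) q e) = fst e"
    "vpart c q (coord_vec TA (ind c) q e) = snd e + Gam c (fst q) (snd q c) (fst e)"
  using T.coord_vec_self[OF ind_TA mem_ind_dom] assms by (simp_all add: hpart_def vpart_def)

lemma G_combine:
  "G c p (a *\<^sub>R u + b *\<^sub>R v) w = a * G c p u w + b * G c p v w"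
  "G c p w (a *\<^sub>R u + b *\<^sub>R v) = a * G c p w u + b * G c p w v"
  by (simp_all add: linear_add[OF linear_G(1)] linear_cmul[OF linear_G(1)]
      linear_add[OF linear_G(2)] linear_cmul[OF linear_G(2)])

lemma G_scale: "G c p (a *\<^sub>R u) (b *\<^sub>R v) = a * b * G c p u v"
  by (simp add: linear_cmul[OF linear_G(1)] linear_cmul[OF linear_G(2)])

lemma fibre_norm_pos:
  assumes "q \<in> TM" "c \<in> A" "fst q \<in> chart_dom c"
  shows "N c q > 0"
  using assms by (simp add: fibre_norm_eq G_pos slit_component_nonzero)

text \<open>Passing from components to parts is triangular: once the horizontal part is fixed, the
  vertical part is a translate of the fibre component.\<close>

lemma tangent_eq_partsI:
  assumes "q \<in> TM" "c \<in> A" "fst q \<in> chart_dom c"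
    and "\<xi> \<in> tangent_space TA q" "\<eta> \<in> tangent_space TA q"
    and "hpart c \<xi> = hpart c \<eta>" "vpart c q \<xi> = vpart c q \<eta>"
  shows "\<xi> = \<eta>"
  by (rule T.tangent_eqI[OF assms(4,5) ind_TA[OF assms(2)] mem_ind_dom[OF assms(1,3)]])
    (use assms(6,7) in \<open>auto simp: hpart_def vpart_def prod_eq_iff\<close>)

text \<open>For the vertical part, the second derivative in the bundle transition is the one that
  \<open>Gam_jac\<close> supplies. The two arise with their arguments in opposite order, hence
  \<open>D2_sym\<close>.\<close>

lemma parts_jac:
  assumes q: "q \<in> TM" and c: "c \<in> A" "fst q \<in> chart_dom c" and d: "d \<in> A" "fst q \<in> chart_dom d"
    and \<xi>: "\<xi> \<in> tangent_space TA q"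
  shows "hpart d \<xi> = jac c d (fst q) (hpart c \<xi>)" "vpart d q \<xi> = jac c d (fst q) (vpart c q \<xi>)"
proof -
  let ?J = "jac c d (fst q)"
  have cd: "c \<in> A" "d \<in> A" "fst q \<in> chart_dom c" "fst q \<in> chart_dom d"
    using c d by auto
  obtain u w where uw: "\<xi> (ind c) = (u, w)" by force
  have y: "snd q d = ?J (snd q c)"
    by (rule tangent_jac[OF slit_tangent[OF q] c d])
  have "\<xi> (ind d) = fd (transition (ind c) (ind d)) (chart_map (ind c) q) (\<xi> (ind c))"
    by (rule T.tangent_jac[OF \<xi> ind_TA mem_ind_dom ind_TA mem_ind_dom]) (use q c d in auto)
  then have \<xi>d: "\<xi> (ind d) = (?J u, ?J w + D2 c d (fst q) u (snd q c))"
    using induced_transition_derivative[OF cd slit_component_nonzero[OF q c]]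
    by (simp add: induced_map uw)
  show h: "hpart d \<xi> = ?J (hpart c \<xi>)"
    by (simp add: hpart_def \<xi>d uw)
  show "vpart d q \<xi> = ?J (vpart c q \<xi>)"
    by (simp add: vpart_def hpart_def \<xi>d uw y linear_add[OF linear_jac[OF cd]] Gam_jac[OF cd]
        D2_sym[OF cd, of u])
qed

section \<open>Independence of the chart and the global tensors\<close>

lemma fibre_norm_chart_indep:
  assumes "q \<in> TM" "c \<in> A" "fst q \<in> chart_dom c" "d \<in> A" "fst q \<in> chart_dom d"
  shows "N d q = N c q"
  using tangent_jac[OF slit_tangent[OF assms(1)] assms(2-5)] G_jac[OF assms(2,4,3,5)]
  by (simp add: fibre_norm_eq)

lemma h_J_eq:
  assumes q: "q \<in> TM" and c: "c \<in> A" "fst q \<in> chart_dom c"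
    and \<xi>: "\<xi> \<in> tangent_space TA q" and \<eta>: "\<eta> \<in> tangent_space TA q"
  shows "h_J M A g q \<xi> \<eta> = - 2 * G c (fst q) (hpart c \<xi>) (hpart c \<eta>)
    + 2 / (N c q)\<^sup>2 * G c (fst q) (vpart c q \<xi>) (vpart c q \<eta>)"
proof -
  have indep: "h_J_local M A g d q \<xi> \<eta> = h_J_local M A g c q \<xi> \<eta>"
    if d: "d \<in> A" "fst q \<in> chart_dom d" for d
    by (simp add: h_J_local_eq parts_jac[OF q c d \<xi>] parts_jac[OF q c d \<eta>] G_jac[OF c(1) d(1) c(2) d(2)]
        fibre_norm_chart_indep[OF q c d])
  have "h_J M A g q \<xi> \<eta> = h_J_local M A g c q \<xi> \<eta>"
    unfolding h_J_def
  proof (rule the_equality)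
    show "\<forall>d\<in>A. fst q \<in> chart_dom d \<longrightarrow> h_J_local M A g c q \<xi> \<eta> = h_J_local M A g d q \<xi> \<eta>"
      by (intro ballI impI indep[symmetric])
  \<comment> \<open>Uniqueness rests on the presence of the chart \<open>c\<close> around the base
    point; with no such chart the description would be satisfied vacuously by every number.\<close>
  qed (use c in blast)
  then show ?thesis
    by (simp add: h_J_local_eq)
qed

text \<open>The image has horizontal part \<open>vpart\<close> divided by the norm and vertical part
  \<open>hpart\<close> times the norm; subtracting \<open>Gam\<close> of the new horizontal part
  converts the vertical part back into a fibre component.\<close>

definition Q_comp :: "('p, real^'n) chart \<Rightarrow> ('p, real^'n) tpoint \<Rightarrow> ('p, real^'n) ttvec \<Rightarrow> (real^'n) \<times> (real^'n)"
  where "Q_comp c q \<xi> = ((1 / N c q) *\<^sub>R vpart c q \<xi>,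
    N c q *\<^sub>R hpart c \<xi> - Gam c (fst q) (snd q c) ((1 / N c q) *\<^sub>R vpart c q \<xi>))"

lemma hor_frame_eq:
  assumes q: "q \<in> TM" and c: "c \<in> A" "fst q \<in> chart_dom c"
  shows "hor_frame M A g c i q =
    coord_vec TA (ind c) q (axis i 1, - Gam c (fst q) (snd q c) (axis i 1))"
proof
  fix C
  note lin = T.linear_coord_vec[OF ind_TA[OF c(1)] mem_ind_dom[OF q c(2)]]
  have "Gam c (fst q) (snd q c) (axis i 1) =
      (\<Sum>m\<in>UNIV. (\<Sum>a\<in>UNIV. snd q c $ a * christoffel A g c a i m (fst q)) *\<^sub>R axis m 1)"
    using basis_expansion[of "Gam c (fst q) (snd q c) (axis i 1)"]
    by (simp add: Gam_def scalar_mult_eq_scaleR)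
  then have eq: "(axis i 1, - Gam c (fst q) (snd q c) (axis i 1)) = (axis i 1, 0) -
      (\<Sum>m\<in>UNIV. (\<Sum>a\<in>UNIV. snd q c $ a * christoffel A g c a i m (fst q)) *\<^sub>R (0, axis m 1))"
    by (simp add: prod_eq_iff fst_sum snd_sum)
  show "hor_frame M A g c i q C =
      coord_vec TA (ind c) q (axis i 1, - Gam c (fst q) (snd q c) (axis i 1)) C"
    by (simp only: eq hor_frame_def vert_frame_def linear_diff[OF lin] linear_sum[OF lin] linear_cmul[OF lin])
qed

text \<open>\<open>coord_vec\<close> is linear in the component vector, so the frame expansion
  collapses to a single coordinate vector. This shows that the local value is tangent and makes its
  two parts accessible.\<close>

lemma Q_tilde_local_eq:
  assumes q: "q \<in> TM" and c: "c \<in> A" "fst q \<in> chart_dom c"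
  shows "Q_tilde_local M A g c q \<xi> = coord_vec TA (ind c) q (Q_comp c q \<xi>)"
proof
  fix C
  note lin = T.linear_coord_vec[OF ind_TA[OF c(1)] mem_ind_dom[OF q c(2)]]
  let ?\<Gamma> = "Gam c (fst q) (snd q c)"
  have ex: "v = (\<Sum>i\<in>UNIV. v $ i *\<^sub>R axis i 1)" for v :: "real^'n"
    using basis_expansion[of v] by (simp add: scalar_mult_eq_scaleR)
  have 1: "(\<Sum>i\<in>UNIV. hpart c \<xi> $ i *\<^sub>R (N c q *\<^sub>R axis i 1)) = N c q *\<^sub>R hpart c \<xi>"
    by (subst (2) ex) (simp add: scaleR_sum_right mult.commute)
  have 2: "(\<Sum>i\<in>UNIV. vpart c q \<xi> $ i *\<^sub>R ((1 / N c q) *\<^sub>R axis i 1)) = (1 / N c q) *\<^sub>R vpart c q \<xi>"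
    by (subst (2) ex) (simp add: scaleR_sum_right mult.commute)
  have 3: "(\<Sum>i\<in>UNIV. vpart c q \<xi> $ i *\<^sub>R ((1 / N c q) *\<^sub>R ?\<Gamma> (axis i 1))) = ?\<Gamma> ((1 / N c q) *\<^sub>R vpart c q \<xi>)"
    unfolding 2[symmetric] by (simp only: linear_sum[OF linear_Gam(2)] linear_cmul[OF linear_Gam(2)])
  have "Q_comp c q \<xi> = (\<Sum>i\<in>UNIV. hpart c \<xi> $ i *\<^sub>R (N c q *\<^sub>R (0, axis i 1))) +
      (\<Sum>i\<in>UNIV. vpart c q \<xi> $ i *\<^sub>R ((1 / N c q) *\<^sub>R (axis i 1, - ?\<Gamma> (axis i 1))))"
    unfolding prod_eq_iff Q_comp_def 1[symmetric] 3[symmetric]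
    using 2 by (simp add: fst_sum snd_sum sum_negf)
  then show "Q_tilde_local M A g c q \<xi> C = coord_vec TA (ind c) q (Q_comp c q \<xi>) C"
    by (simp only: Q_tilde_local_def dx_eq delta_y_eq hor_frame_eq[OF assms] vert_frame_def
        linear_add[OF lin] linear_sum[OF lin] linear_cmul[OF lin])
qed

lemma Q_comp_parts:
  assumes q: "q \<in> TM" and c: "c \<in> A" "fst q \<in> chart_dom c"
  shows "hpart c (coord_vec TA (ind c) q (Q_comp c q \<xi>)) = (1 / N c q) *\<^sub>R vpart c q \<xi>"
    "vpart c q (coord_vec TA (ind c) q (Q_comp c q \<xi>)) = N c q *\<^sub>R hpart c \<xi>"
  by (simp_all add: parts_coord_vec[OF assms] Q_comp_def)

text \<open>Two local values are compared through their parts in one chart: the Jacobian commutes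
  with the scalar factors, and these are the same in all charts.\<close>

lemma Q_tilde_eq:
  assumes q: "q \<in> TM" and c: "c \<in> A" "fst q \<in> chart_dom c" and \<xi>: "\<xi> \<in> tangent_space TA q"
  shows "Q_tilde M A g q \<xi> = coord_vec TA (ind c) q (Q_comp c q \<xi>)"
proof -
  have T: "coord_vec TA (ind d) q e \<in> tangent_space TA q" if "d \<in> A" "fst q \<in> chart_dom d" for d e
    by (rule T.coord_vec_tangent[OF ind_TA mem_ind_dom]) (use q that in auto)
  have indep: "Q_tilde_local M A g d q \<xi> = Q_tilde_local M A g c q \<xi>"
    if d: "d \<in> A" "fst q \<in> chart_dom d" for d
    unfolding Q_tilde_local_eq[OF q c] Q_tilde_local_eq[OF q d]
    by (rule tangent_eq_partsI[OF q d T[OF d] T[OF c]])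
      (simp_all add: Q_comp_parts[OF q d] parts_jac[OF q c d T[OF c]] Q_comp_parts[OF q c]
        parts_jac[OF q c d \<xi>] fibre_norm_chart_indep[OF q c d]
        linear_cmul[OF linear_jac[OF c(1) d(1) c(2) d(2)]])
  have "Q_tilde M A g q \<xi> = Q_tilde_local M A g c q \<xi>"
    unfolding Q_tilde_def
  proof (rule the_equality)
    show "\<forall>d\<in>A. fst q \<in> chart_dom d \<longrightarrow> Q_tilde_local M A g c q \<xi> = Q_tilde_local M A g d q \<xi>"
      by (intro ballI impI indep[symmetric])
  qed (use c in blast)
  then show ?thesis
    by (simp add: Q_tilde_local_eq[OF q c])
qed

section \<open>Pointwise algebra of the two tensors\<close>

lemma Q_tilde_tangent:
  assumes "q \<in> TM" "\<xi> \<in> tangent_space TA q"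
  shows "Q_tilde M A g q \<xi> \<in> tangent_space TA q"
proof -
  obtain c where c: "c \<in> A" "fst q \<in> chart_dom c"
    using slit_chart_exists[OF assms(1)] .
  show ?thesis
    unfolding Q_tilde_eq[OF assms(1) c assms(2)]
    by (rule T.coord_vec_tangent[OF ind_TA[OF c(1)] mem_ind_dom[OF assms(1) c(2)]])
qed

lemma Q_tilde_parts:
  assumes "q \<in> TM" "c \<in> A" "fst q \<in> chart_dom c" "\<xi> \<in> tangent_space TA q"
  shows "hpart c (Q_tilde M A g q \<xi>) = (1 / N c q) *\<^sub>R vpart c q \<xi>"
    "vpart c q (Q_tilde M A g q \<xi>) = N c q *\<^sub>R hpart c \<xi>"
  by (simp_all add: Q_tilde_eq[OF assms] Q_comp_parts[OF assms(1-3)])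

lemma Q_tilde_involutive:
  assumes q: "q \<in> TM" and \<xi>: "\<xi> \<in> tangent_space TA q"
  shows "Q_tilde M A g q (Q_tilde M A g q \<xi>) = \<xi>"
proof -
  obtain c where c: "c \<in> A" "fst q \<in> chart_dom c"
    using slit_chart_exists[OF q] .
  note Q = Q_tilde_tangent[OF q \<xi>]
  show ?thesis
    by (rule tangent_eq_partsI[OF q c Q_tilde_tangent[OF q Q] \<xi>])
      (use fibre_norm_pos[OF q c] in \<open>simp_all add: Q_tilde_parts[OF q c Q] Q_tilde_parts[OF q c \<xi>]\<close>)
qed

text \<open>The swap sends -2 to the vertical parts with a factor 1 / norm^2, and 2 / norm^2 to the
  horizontal parts with a factor norm^2: the original coefficients with opposite signs.\<close>

lemma h_J_Q_tilde:
  assumes q: "q \<in> TM" and \<xi>: "\<xi> \<in> tangent_space TA q" and \<eta>: "\<eta> \<in> tangent_space TA q"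
  shows "h_J M A g q (Q_tilde M A g q \<xi>) (Q_tilde M A g q \<eta>) = - h_J M A g q \<xi> \<eta>"
proof -
  obtain c where c: "c \<in> A" "fst q \<in> chart_dom c"
    using slit_chart_exists[OF q] .
  show ?thesis
    unfolding h_J_eq[OF q c \<xi> \<eta>] h_J_eq[OF q c Q_tilde_tangent[OF q \<xi>] Q_tilde_tangent[OF q \<eta>]]
      Q_tilde_parts[OF q c \<xi>] Q_tilde_parts[OF q c \<eta>] G_scale
    using fibre_norm_pos[OF q c] by (simp add: power2_eq_square)
qed

section \<open>Smoothness of the two tensors\<close>

abbreviation slit_image :: "('p, real^'n) chart \<Rightarrow> ((real^'n) \<times> (real^'n)) set" where
  "slit_image c \<equiv> chart_map c ` chart_dom c \<times> (- {0})"

lemma open_slit_image: "c \<in> A \<Longrightarrow> open (slit_image c)"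
  by (intro open_Times open_chart_image) auto

lemma smooth_on_base:
  assumes c: "c \<in> A" and f: "smooth_on f (chart_map c ` chart_dom c)"
  shows "smooth_on (\<lambda>z. f (fst z)) (slit_image c)"
  by (rule smooth_on_compose[OF open_slit_image[OF c] open_chart_image[OF c] _ f
        smooth_on_bounded_linear[OF open_slit_image[OF c] bounded_linear_fst
          smooth_on_ident[OF open_slit_image[OF c]]]]) auto

lemma smooth_on_fibre: "c \<in> A \<Longrightarrow> smooth_on snd (slit_image c)"
  using smooth_on_bounded_linear[OF open_slit_image bounded_linear_snd smooth_on_ident[OF open_slit_image]]
  by simp

lemma smooth_on_G:
  assumes c: "c \<in> A" and u: "smooth_on u (slit_image c)" and v: "smooth_on v (slit_image c)"
  shows "smooth_on (\<lambda>z. G c (chart_inv c (fst z)) (u z) (v z)) (slit_image c)"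
  unfolding G_def
  by (intro smooth_on_sum smooth_on_mult smooth_on_vec_nth u v open_slit_image c
      smooth_on_base[OF c smooth_gc[OF c], unfolded o_def])

lemma smooth_on_Gam:
  assumes c: "c \<in> A" and u: "smooth_on u (slit_image c)" and v: "smooth_on v (slit_image c)"
  shows "smooth_on (\<lambda>z. Gam c (chart_inv c (fst z)) (u z) (v z)) (slit_image c)"
  unfolding Gam_def
  by (intro smooth_on_vec_lambda smooth_on_sum smooth_on_mult smooth_on_vec_nth u v open_slit_image c
      smooth_on_base[OF c smooth_christoffel[OF c]])

lemma slit_image_cases:
  assumes c: "c \<in> A" and z: "z \<in> slit_image c"
  shows "chart_inv (ind c) z \<in> TM" "fst (chart_inv (ind c) z) = chart_inv c (fst z)"
    "snd (chart_inv (ind c) z) c = snd z" "chart_inv c (fst z) \<in> chart_dom c" "snd z \<noteq> 0"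
proof -
  obtain p y where "p \<in> chart_dom c" "y \<noteq> 0" "z = (chart_map c p, y)"
    using z by auto
  then show "chart_inv (ind c) z \<in> TM" "fst (chart_inv (ind c) z) = chart_inv c (fst z)"
    "snd (chart_inv (ind c) z) c = snd z" "chart_inv c (fst z) \<in> chart_dom c" "snd z \<noteq> 0"
    using c by (auto simp: induced_inv slit_point)
qed

text \<open>Together with \<open>Ncomp\<close>, the vertical part of a constant coordinate field and
  the fibre norm as functions of the bundle coordinates \<open>z\<close>. They only involve the base
  chart, so the smoothness rules apply term by term.\<close>

definition vcomp :: "('p, real^'n) chart \<Rightarrow> (real^'n) \<times> (real^'n) \<Rightarrow> (real^'n) \<times> (real^'n) \<Rightarrow> real^'n" where
  "vcomp c e z = snd e + Gam c (chart_inv c (fst z)) (snd z) (fst e)"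

definition Ncomp :: "('p, real^'n) chart \<Rightarrow> (real^'n) \<times> (real^'n) \<Rightarrow> real" where
  "Ncomp c z = sqrt (G c (chart_inv c (fst z)) (snd z) (snd z))"

lemma local_expressions:
  assumes c: "c \<in> A" and z: "z \<in> slit_image c"
  shows "hpart c (coord_vec TA (ind c) (chart_inv (ind c) z) e) = fst e"
    "vpart c (chart_inv (ind c) z) (coord_vec TA (ind c) (chart_inv (ind c) z) e) = vcomp c e z"
    "N c (chart_inv (ind c) z) = Ncomp c z" "Ncomp c z > 0"
  using slit_image_cases[OF c z] parts_coord_vec[OF slit_image_cases(1)[OF c z] c, of e] c
  by (simp_all add: vcomp_def Ncomp_def fibre_norm_eq G_pos)

lemma smooth_on_vcomp: "c \<in> A \<Longrightarrow> smooth_on (vcomp c e) (slit_image c)"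
  unfolding vcomp_def[abs_def]
  by (intro smooth_on_add smooth_on_const smooth_on_Gam smooth_on_fibre open_slit_image)

lemma smooth_on_Ncomp:
  assumes c: "c \<in> A"
  shows "smooth_on (Ncomp c) (slit_image c)"
  unfolding Ncomp_def[abs_def]
  by (intro smooth_on_sqrt smooth_on_G smooth_on_fibre open_slit_image c)
    (use local_expressions(4)[OF c] in \<open>auto simp: Ncomp_def\<close>)

lemma coord_vec_tangent_slit:
  assumes c: "c \<in> A" and z: "z \<in> slit_image c"
  shows "coord_vec TA (ind c) (chart_inv (ind c) z) e \<in> tangent_space TA (chart_inv (ind c) z)"
  by (rule T.coord_vec_tangent[OF ind_TA[OF c] mem_ind_dom]) (use slit_image_cases[OF c z] in auto)

lemma tensor_02_h_J: "tensor_02 TM TA (h_J M A g)"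
  unfolding tensor_02_def
proof (intro conjI ballI allI)
  fix q u v w a b
  assume q: "q \<in> TM" and u: "u \<in> tangent_space TA q" and v: "v \<in> tangent_space TA q"
    and w: "w \<in> tangent_space TA q"
  obtain c where c: "c \<in> A" "fst q \<in> chart_dom c"
    using slit_chart_exists[OF q] .
  note h = h_J_eq[OF q c]
  show "h_J M A g q (\<lambda>c. a *\<^sub>R u c + b *\<^sub>R v c) w = a * h_J M A g q u w + b * h_J M A g q v w"
    unfolding h[OF T.tangent_combine[OF u v] w] h[OF u w] h[OF v w] hpart_combine vpart_combine G_combine
    by (simp add: algebra_simps add_divide_distrib)
  show "h_J M A g q w (\<lambda>c. a *\<^sub>R u c + b *\<^sub>R v c) = a * h_J M A g q w u + b * h_J M A g q w v"
    unfolding h[OF w T.tangent_combine[OF u v]] h[OF w u] h[OF w v] hpart_combine vpart_combine G_combine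
    by (simp add: algebra_simps add_divide_distrib)
next
  fix C and e f :: "(real^'n) \<times> (real^'n)"
  assume "C \<in> TA"
  then obtain c where c: "c \<in> A" and C: "C = ind c" by (auto simp: slit_atlas_def)
  note op = open_slit_image[OF c]
  show "smooth_on (\<lambda>x. h_J M A g (chart_inv C x) (coord_vec TA C (chart_inv C x) e)
      (coord_vec TA C (chart_inv C x) f)) (chart_map C ` chart_dom C)"
    unfolding C induced_image[OF c]
  proof (rule smooth_on_cong[OF op])
    \<comment> \<open>A product replaces the square of the norm, to match the closure rules for
      smooth functions.\<close>
    show "smooth_on (\<lambda>z. - 2 * G c (chart_inv c (fst z)) (fst e) (fst f)
        + 2 / (Ncomp c z * Ncomp c z) * G c (chart_inv c (fst z)) (vcomp c e z) (vcomp c f z)) (slit_image c)"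
      by (intro smooth_on_add smooth_on_mult smooth_on_divide smooth_on_const smooth_on_G
          smooth_on_vcomp smooth_on_Ncomp op c) (use local_expressions(4)[OF c] in force)
  qed (simp add: h_J_eq[OF slit_image_cases(1)[OF c] c _ coord_vec_tangent_slit[OF c] coord_vec_tangent_slit[OF c]]
      slit_image_cases[OF c] local_expressions[OF c] power2_eq_square)
qed

lemma tensor_11_Q_tilde: "tensor_11 TM TA (Q_tilde M A g)"
  unfolding tensor_11_def
proof (intro conjI ballI allI)
  show "Q_tilde M A g q u \<in> tangent_space TA q" if "q \<in> TM" "u \<in> tangent_space TA q" for q u
    by (rule Q_tilde_tangent[OF that])
next
  fix q u v a b
  assume q: "q \<in> TM" and u: "u \<in> tangent_space TA q" and v: "v \<in> tangent_space TA q"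
  obtain c where c: "c \<in> A" "fst q \<in> chart_dom c"
    using slit_chart_exists[OF q] .
  have "Q_comp c q (\<lambda>c. a *\<^sub>R u c + b *\<^sub>R v c) = a *\<^sub>R Q_comp c q u + b *\<^sub>R Q_comp c q v"
    unfolding Q_comp_def hpart_combine vpart_combine
    by (simp add: linear_add[OF linear_Gam(2)] linear_cmul[OF linear_Gam(2)] algebra_simps)
  then show "Q_tilde M A g q (\<lambda>c. a *\<^sub>R u c + b *\<^sub>R v c) =
      (\<lambda>c. a *\<^sub>R Q_tilde M A g q u c + b *\<^sub>R Q_tilde M A g q v c)"
    using T.coord_vec_combine[OF ind_TA[OF c(1)] mem_ind_dom[OF q c(2)]]
    by (simp add: Q_tilde_eq[OF q c] u v T.tangent_combine)
next
  fix C and e :: "(real^'n) \<times> (real^'n)"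
  assume "C \<in> TA"
  then obtain c where c: "c \<in> A" and C: "C = ind c" by (auto simp: slit_atlas_def)
  note op = open_slit_image[OF c]
  show "smooth_on (\<lambda>x. Q_tilde M A g (chart_inv C x) (coord_vec TA C (chart_inv C x) e) C)
      (chart_map C ` chart_dom C)"
    unfolding C induced_image[OF c]
  proof (rule smooth_on_cong[OF op])
    show "smooth_on (\<lambda>z. ((1 / Ncomp c z) *\<^sub>R vcomp c e z,
        Ncomp c z *\<^sub>R fst e - Gam c (chart_inv c (fst z)) (snd z) ((1 / Ncomp c z) *\<^sub>R vcomp c e z)))
        (slit_image c)"
      by (intro smooth_on_Pair smooth_on_diff smooth_on_scaleR smooth_on_divide smooth_on_const
          smooth_on_Gam smooth_on_fibre smooth_on_vcomp smooth_on_Ncomp op c)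
        (use local_expressions(4)[OF c] in force)+
    fix z assume z: "z \<in> slit_image c"
    let ?q = "chart_inv (ind c) z"
    have q: "?q \<in> TM" "fst ?q \<in> chart_dom c"
      using slit_image_cases[OF c z] by auto
    show "((1 / Ncomp c z) *\<^sub>R vcomp c e z,
        Ncomp c z *\<^sub>R fst e - Gam c (chart_inv c (fst z)) (snd z) ((1 / Ncomp c z) *\<^sub>R vcomp c e z)) =
        Q_tilde M A g ?q (coord_vec TA (ind c) ?q e) (ind c)"
      by (simp add: Q_tilde_eq[OF q(1) c q(2) coord_vec_tangent_slit[OF c z]]
          T.coord_vec_self[OF ind_TA[OF c] mem_ind_dom[OF q]] Q_comp_def local_expressions[OF c z]
          slit_image_cases[OF c z])
  qed
qed

lemma h_J_nondegenerate:
  assumes q: "q \<in> TM" and \<xi>: "\<xi> \<in> tangent_space TA q"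
    and zero: "\<And>\<eta>. \<eta> \<in> tangent_space TA q \<Longrightarrow> h_J M A g q \<xi> \<eta> = 0"
  shows "\<xi> = (\<lambda>_. 0)"
proof -
  obtain c where c: "c \<in> A" "fst q \<in> chart_dom c"
    using slit_chart_exists[OF q] .
  let ?u = "hpart c \<xi>" and ?v = "vpart c q \<xi>"
  \<comment> \<open>The test vector has parts \<open>?u\<close> and \<open>- ?v\<close>: reversing
    the vertical part makes both summands of the indefinite form nonpositive, so each vanishes. The
    \<open>Gam\<close> term cancels the one in \<open>vpart\<close>.\<close>
  define \<eta> where "\<eta> = coord_vec TA (ind c) q (?u, - ?v - Gam c (fst q) (snd q c) ?u)"
  have \<eta>: "\<eta> \<in> tangent_space TA q"
    unfolding \<eta>_def by (rule T.coord_vec_tangent[OF ind_TA[OF c(1)] mem_ind_dom[OF q c(2)]])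
  have p: "hpart c \<eta> = ?u" "vpart c q \<eta> = - ?v"
    by (simp_all add: \<eta>_def parts_coord_vec[OF q c])
  have "G c (fst q) ?u ?u + 1 / (N c q)\<^sup>2 * G c (fst q) ?v ?v = 0"
    using zero[OF \<eta>] by (simp add: h_J_eq[OF q c \<xi> \<eta>] p linear_neg[OF linear_G(2)])
  moreover have "G c (fst q) ?u ?u \<ge> 0" "1 / (N c q)\<^sup>2 * G c (fst q) ?v ?v \<ge> 0"
    by (simp_all add: G_nonneg[OF c])
  ultimately have "G c (fst q) ?u ?u = 0" "1 / (N c q)\<^sup>2 * G c (fst q) ?v ?v = 0"
    by linarith+
  then have "?u = 0" "?v = 0"
    using G_pos[OF c, of ?u] G_pos[OF c, of ?v] fibre_norm_pos[OF q c] by fastforce+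
  then show ?thesis
    by (intro tangent_eq_partsI[OF q c \<xi> T.zero_tangent])
      (simp_all add: hpart_def vpart_def linear_0[OF linear_Gam(2)])
qed

lemma pseudo_riemannian_h_J: "pseudo_riemannian_metric TM TA (h_J M A g)"
  unfolding pseudo_riemannian_metric_def
proof (intro conjI ballI impI tensor_02_h_J)
  fix q u v assume q: "q \<in> TM" and u: "u \<in> tangent_space TA q" and v: "v \<in> tangent_space TA q"
  obtain c where c: "c \<in> A" "fst q \<in> chart_dom c"
    using slit_chart_exists[OF q] .
  show "h_J M A g q u v = h_J M A g q v u"
    by (simp add: h_J_eq[OF q c] u v G_sym[OF c, of "hpart c u"] G_sym[OF c, of "vpart c q u"])
qed (use h_J_nondegenerate in blast)

lemma almost_para_hermitian_slit:
  assumes "smooth_manifold M A"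
  shows "almost_para_hermitian_manifold TM TA (h_J M A g) (Q_tilde M A g)"
  unfolding almost_para_hermitian_manifold_def
proof (intro conjI ballI allI impI smooth_manifold_slit assms pseudo_riemannian_h_J tensor_11_Q_tilde)
  show "Q_tilde M A g q (Q_tilde M A g q u) = u" if "q \<in> TM" "u \<in> tangent_space TA q" for q u
    by (rule Q_tilde_involutive[OF that])
  show "h_J M A g q (Q_tilde M A g q (X q)) (Q_tilde M A g q (Y q)) = - h_J M A g q (X q) (Y q)"
    if "vector_field TM TA X \<and> vector_field TM TA Y" "q \<in> TM" for X Y q
    using that by (intro h_J_Q_tilde) (auto simp: vector_field_def)
qed

end

theorem theorem16:
  fixes M :: "'p set"
    and A :: "('p, real^'n) chart set"
    and g :: "'p \<Rightarrow> ('p, real^'n) tvec \<Rightarrow> ('p, real^'n) tvec \<Rightarrow> real"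
  assumes "riemannian_manifold M A g"
  shows "almost_para_hermitian_manifold (slit_tangent_bundle M A) (slit_atlas M A)
           (h_J M A g) (Q_tilde M A g)"
proof -
  interpret riemannian M A g
    using assms by unfold_locales (auto simp: riemannian_manifold_def smooth_manifold_def)
  show ?thesis
    using assms by (intro almost_para_hermitian_slit) (simp add: riemannian_manifold_def)
qed

end
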